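(* Let $m,n\ge 1$, let $\mathbf w=(w_j)_{j=1}^m$ be a positive probability vector and let $\mathbf A=(A_j)_{j=1}^m$ be an $m$-tuple of positive definite matrices in $\mathbb{M}_n$. For every real $r$ with $-1\le r<0$ and every real $q>0$, $$\bigl\|P_r(\mathbf w;\mathbf A)\bigr\|_q\le p_r\bigl(\mathbf w;(\|A_j\|_q)_{j=1}^m\bigr),$$ where $P_r(\mathbf w;\mathbf A)$ is the Lim--Pálfia power mean of order $r$, $p_r$ is the scalar power mean, and $\|\cdot\|_q$ denotes the Schatten $q$-norm for $q\ge1$ and the Schatten $q$-quasi-norm for $0<q<1$.
   Context: $\mathbb{M}_n$ is the algebra of complex $n\times n$ matrices; positive definite matrices are Hermitian with strictly positive eigenvalues. A positive probability vector is $\mathbf w=(w_j)_{j=1}^m$ with all $w_j>0$ and $\sum_j w_j=1$. Scalar power mean: for a positive vector $\mathbf a=(a_j)_{j=1}^m$ and real $r\ne 0$, $p_r(\mathbf w;\mathbf a):=\bigl(\sum_{j=1}^m w_ja_j^r\bigr)^{1/r}$. Weighted geometric mean: $A\#_tB:=A^{1/2}(A^{-1/2}BA^{-1/2})^tA^{1/2}$ for positive definite $A,B$. Lim--Pálfia power means: for $0<t\le 1$, the equation $X=\sum_{j=1}^m w_j\,(X\#_tA_j)$ has a unique positive definite solution $X$ (a known result), and $P_t(\mathbf w;\mathbf A)$ is defined to be this solution. For $-1\le r<0$, $P_r(\mathbf w;\mathbf A):=P_{-r}(\mathbf w;\mathbf A^{-1})^{-1}$, where $\mathbf A^{-1}:=(A_j^{-1})_{j=1}^m$.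 Schatten (quasi-)norm: $\|A\|_q:=\bigl(\operatorname{Tr}|A|^q\bigr)^{1/q}$ with $|A|=(A^*A)^{1/2}$; for positive definite $A$ with eigenvalues $\lambda_1,\dots,\lambda_n$ this is $\bigl(\sum_{i=1}^n\lambda_i^q\bigr)^{1/q}$. *)

theory Defs
  imports "HOL-Analysis.Analysis"
begin

definition ctranspose :: "complex ^ 'n ^ 'm \<Rightarrow> complex ^ 'm ^ 'n" where
  "ctranspose A = (\<chi> i j. cnj (A $ j $ i))"

definition hermitian :: "complex ^ 'n ^ 'n \<Rightarrow> bool" where
  "hermitian A \<longleftrightarrow> ctranspose A = A"

definition unitary :: "complex ^ 'n ^ 'n \<Rightarrow> bool" where
  "unitary U \<longleftrightarrow> ctranspose U ** U = mat 1 \<and> U ** ctranspose U = mat 1"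

definition eigenvalue :: "complex ^ 'n ^ 'n \<Rightarrow> complex \<Rightarrow> bool" where
  "eigenvalue A c \<longleftrightarrow> (\<exists>x. x \<noteq> 0 \<and> A *v x = c *s x)"

definition pos_def :: "complex ^ 'n ^ 'n \<Rightarrow> bool" where
  "pos_def A \<longleftrightarrow> hermitian A \<and> (\<forall>c. eigenvalue A c \<longrightarrow> c \<in> \<real> \<and> 0 < Re c)"

definition diag_mat :: "real ^ 'n \<Rightarrow> complex ^ 'n ^ 'n" where
  "diag_mat d = (\<chi> i j. if i = j then complex_of_real (d $ i) else 0)"

text \<open>
  Functional calculus for Hermitian matrices: if \<open>A = U diag(d) U\<^sup>*\<close> with \<open>U\<close> unitary, then
  \<open>f(A) = U diag(f(d)) U\<^sup>*\<close>. For Hermitian \<open>A\<close> such a decomposition exists and the result does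
  not depend on its choice.
\<close>
definition mat_fun :: "(real \<Rightarrow> real) \<Rightarrow> complex ^ 'n ^ 'n \<Rightarrow> complex ^ 'n ^ 'n" where
  "mat_fun f A = (THE B. \<exists>U d. unitary U \<and> A = U ** diag_mat d ** ctranspose U
                           \<and> B = U ** diag_mat (\<chi> i. f (d $ i)) ** ctranspose U)"

text \<open>
  Real powers are meant for positive definite matrices, and for positive exponents also for positive
  semidefinite ones (recall \<open>0 powr t = 0\<close>).
\<close>
definition mat_powr :: "complex ^ 'n ^ 'n \<Rightarrow> real \<Rightarrow> complex ^ 'n ^ 'n" where
  "mat_powr A t = mat_fun (\<lambda>x. x powr t) A"

definition mat_abs :: "complex ^ 'n ^ 'n \<Rightarrow> complex ^ 'n ^ 'n" where
  "mat_abs A = mat_powr (ctranspose A ** A) (1/2)"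

text \<open>The trace below is that of a positive semidefinite matrix, hence real and nonnegative.\<close>
definition schatten :: "real \<Rightarrow> complex ^ 'n ^ 'n \<Rightarrow> real" where
  "schatten q A = Re (trace (mat_powr (mat_abs A) q)) powr (1/q)"

definition geo_mean :: "real \<Rightarrow> complex ^ 'n ^ 'n \<Rightarrow> complex ^ 'n ^ 'n \<Rightarrow> complex ^ 'n ^ 'n" where
  "geo_mean t A B =
     mat_powr A (1/2) ** mat_powr (mat_powr A (-1/2) ** B ** mat_powr A (-1/2)) t
       ** mat_powr A (1/2)"

text \<open>
  An \<open>m\<close>-tuple is a function on \<open>nat\<close> of which only the values at \<open>1, \<dots>, m\<close> are used.
\<close>
definition scalar_power_mean :: "nat \<Rightarrow> real \<Rightarrow> (nat \<Rightarrow> real) \<Rightarrow> (nat \<Rightarrow> real) \<Rightarrow> real" where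
  "scalar_power_mean m r w a = (\<Sum>j=1..m. w j * a j powr r) powr (1/r)"

text \<open>The Lim--Palfia power mean of order \<open>t\<close>, for \<open>0 < t \<le> 1\<close>.\<close>
definition power_mean_pos ::
    "nat \<Rightarrow> real \<Rightarrow> (nat \<Rightarrow> real) \<Rightarrow> (nat \<Rightarrow> complex ^ 'n ^ 'n) \<Rightarrow> complex ^ 'n ^ 'n" where
  "power_mean_pos m t w A =
     (THE X. pos_def X \<and> X = (\<Sum>j=1..m. w j *\<^sub>R geo_mean t X (A j)))"

text \<open>
  Orders \<open>-1 \<le> r < 0\<close> are reduced to positive ones by inversion. The value for \<open>r = 0\<close> and for
  \<open>\<bar>r\<bar> > 1\<close> carries no meaning.
\<close>
definition power_mean ::
    "nat \<Rightarrow> real \<Rightarrow> (nat \<Rightarrow> real) \<Rightarrow> (nat \<Rightarrow> complex ^ 'n ^ 'n) \<Rightarrow> complex ^ 'n ^ 'n" where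
  "power_mean m r w A =
     (if 0 < r then power_mean_pos m r w A
      else matrix_inv (power_mean_pos m (- r) w (\<lambda>j. matrix_inv (A j))))"

end

theory Submission
  imports Defs
begin

text \<open>
  Write \<open>r = -t\<close> with \<open>0 < t \<le> 1\<close>, let \<open>X\<close> be the power mean of order \<open>t\<close> of the inverses
  \<open>A\<^sub>j\<^sup>-\<^sup>1\<close>, so that the mean of order \<open>r\<close> is \<open>X\<^sup>-\<^sup>1\<close>, and let \<open>g = Tr X\<^sup>-\<^sup>q\<close>, \<open>a\<^sub>j = Tr A\<^sub>j\<^sup>q\<close>.
  Multiplying the equation \<open>X = \<Sum>\<^sub>j w\<^sub>j (X #\<^sub>t A\<^sub>j\<^sup>-\<^sup>1)\<close> by \<open>X\<^sup>-\<^sup>q\<^sup>-\<^sup>1\<close> and taking traces gives \<open>g\<close> as a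
  weighted sum of the numbers \<open>Tr ((X #\<^sub>t A\<^sub>j\<^sup>-\<^sup>1) X\<^sup>-\<^sup>q\<^sup>-\<^sup>1)\<close>. Each of them is at least
  \<open>a\<^sub>j powr (-t/q) * g powr (1 + t/q)\<close> (lemma \<open>rtrace_geo_mean_lower_bound\<close>), and what remains after
  dividing by \<open>g powr (1 + t/q)\<close> is the asserted inequality.

  The lower bound rests on Hoelder's inequality and its reverse for traces \<open>Tr (P\<^sup>a Q\<^sup>1\<^sup>-\<^sup>a)\<close>, which are
  the scalar inequalities with doubly stochastic weights. For \<open>q \<ge> 1\<close> the pencil of \<open>X\<close> and
  \<open>A\<^sub>j\<^sup>-\<^sup>1\<close> reduces the exponent \<open>t\<close> to the exponent \<open>-1\<close>, at which the trace is \<open>Tr (A\<^sub>j X\<^sup>1\<^sup>-\<^sup>q)\<close>.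
  For \<open>q < 1\<close> one needs in addition that \<open>Tr (A #\<^sub>t B)\<^sup>q \<le> (Tr A\<^sup>q) powr (1 - t) * (Tr B\<^sup>q) powr t\<close>.
  This follows from the log-convexity in \<open>t\<close> of \<open>det (1 + s (A #\<^sub>t B))\<close>, which is, in coordinates that
  diagonalise \<open>A\<close> and \<open>B\<close> by congruence, a sum of exponentials with nonnegative coefficients; the
  passage from \<open>ln (1 + s x)\<close> to \<open>x\<^sup>q\<close> is an integration over \<open>s\<close>.

  That the power mean satisfies its defining equation at all is part of the proof. The map
  \<open>X \<mapsto> \<Sum>\<^sub>j w\<^sub>j (X #\<^sub>t A\<^sub>j\<^sup>-\<^sup>1)\<close> is monotone in the Loewner order, by the Loewner-Heinz inequality, and
  homogeneous of degree \<open>1 - t < 1\<close>; such a map has exactly one positive definite fixed point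
  (theorem \<open>loewner_monotone_homogeneous_fixpoint\<close>): existence by monotone iteration, uniqueness because
  the map contracts ratios.
\<close>

section \<open>Matrix arithmetic and adjoints\<close>

lemma ctranspose_ctranspose [simp]: "ctranspose (ctranspose A) = A"
  by (simp add: ctranspose_def vec_eq_iff)

lemma ctranspose_mult: "ctranspose (A ** B) = ctranspose B ** ctranspose A"
  by (simp add: ctranspose_def matrix_matrix_mult_def vec_eq_iff mult.commute)

lemma ctranspose_mat_1 [simp]: "ctranspose (mat 1) = mat 1"
  by (simp add: ctranspose_def mat_def vec_eq_iff)

lemma ctranspose_diag_mat [simp]: "ctranspose (diag_mat d) = diag_mat d"
  by (simp add: ctranspose_def diag_mat_def vec_eq_iff)

lemma ctranspose_scaleR [simp]: "ctranspose (c *\<^sub>R A) = c *\<^sub>R ctranspose A"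
  by (simp add: ctranspose_def vec_eq_iff)

lemma ctranspose_add: "ctranspose (A + B) = ctranspose A + ctranspose B"
  by (simp add: ctranspose_def vec_eq_iff)

lemma ctranspose_0 [simp]: "ctranspose 0 = 0"
  by (simp add: ctranspose_def vec_eq_iff)

lemma ctranspose_sum: "ctranspose (sum f J) = (\<Sum>j\<in>J. ctranspose (f j))"
  by (induction J rule: infinite_finite_induct) (auto simp: ctranspose_add)

lemma mult_vec_scaleR: "(c *\<^sub>R A) *v x = c *\<^sub>R ((A :: complex ^ 'n ^ 'm) *v x)"
  by (simp add: matrix_vector_mult_def vec_eq_iff scaleR_sum_right)

lemma mult_scaleR_vec: "(A :: complex ^ 'n ^ 'm) *v (c *\<^sub>R x) = c *\<^sub>R (A *v x)"
  by (simp add: matrix_vector_mult_def vec_eq_iff scaleR_sum_right)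

lemma mult_vec_sum: "sum f J *v x = (\<Sum>j\<in>J. (f j :: complex ^ 'n ^ 'm) *v x)"
  by (induction J rule: infinite_finite_induct) (auto simp: matrix_vector_mult_add_rdistrib)

lemma matrix_add_rdistrib: "(A + B) ** C = A ** C + B ** (C :: 'a::semiring_1 ^ 'n ^ 'm)"
  by (simp add: vec_eq_iff matrix_matrix_mult_def distrib_right sum.distrib)

lemma matrix_sum_rdistrib: "sum f J ** (C :: 'a::semiring_1 ^ 'n ^ 'm) = (\<Sum>j\<in>J. f j ** C)"
  by (induction J rule: infinite_finite_induct) (auto simp: matrix_add_rdistrib)

lemma inner_ctranspose: "(A *v x) \<bullet> y = x \<bullet> (ctranspose A *v y)"
proof -
  have "(A *v x) \<bullet> y = (\<Sum>i\<in>UNIV. \<Sum>j\<in>UNIV. (A $ i $ j * x $ j) \<bullet> y $ i)"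
    by (simp add: inner_vec_def matrix_vector_mult_def inner_sum_left)
  also have "\<dots> = (\<Sum>j\<in>UNIV. \<Sum>i\<in>UNIV. (A $ i $ j * x $ j) \<bullet> y $ i)"
    by (rule sum.swap)
  also have "\<dots> = (\<Sum>j\<in>UNIV. \<Sum>i\<in>UNIV. x $ j \<bullet> (cnj (A $ i $ j) * y $ i))"
    by (intro sum.cong refl) (simp add: inner_complex_def algebra_simps)
  also have "\<dots> = x \<bullet> (ctranspose A *v y)"
    by (simp add: inner_vec_def matrix_vector_mult_def inner_sum_right ctranspose_def)
  finally show ?thesis .
qed

lemma hermitian_inner: "hermitian H \<Longrightarrow> (H *v x) \<bullet> y = x \<bullet> (H *v y)"
  by (simp add: inner_ctranspose hermitian_def)

section \<open>The spectral theorem\<close>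

lemma smult_ii_inner: "(\<i> *s x) \<bullet> y = - (x \<bullet> (\<i> *s y))"
  by (simp add: inner_vec_def inner_complex_def sum_negf[symmetric] algebra_simps)

lemma mult_smult: "(A :: complex ^ 'n ^ 'm) *v (c *s x) = c *s (A *v x)"
  by (simp add: matrix_vector_mult_def vec_eq_iff sum_distrib_left algebra_simps)

text \<open>
  The inner product on \<open>complex ^ 'n\<close> is the real part of the Hermitian one. A Hermitian matrix is
  self-adjoint for it, so the real Rayleigh quotient argument applies verbatim: a maximiser of
  \<open>x \<bullet> H x\<close> on the unit sphere of an invariant subspace is an eigenvector.
\<close>
lemma hermitian_eigenvector_in_subspace:
  fixes H :: "complex ^ 'n ^ 'n"
  assumes H: "hermitian H" and W: "subspace W" and inv: "\<And>x. x \<in> W \<Longrightarrow> H *v x \<in> W"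
    and nz: "\<exists>x\<in>W. x \<noteq> 0"
  shows "\<exists>x\<in>W. norm x = 1 \<and> (\<exists>l. H *v x = l *\<^sub>R x)"
proof -
  let ?\<phi> = "\<lambda>x. x \<bullet> (H *v x)"
  let ?K = "sphere 0 1 \<inter> W"
  have lin: "linear (\<lambda>x. H *v x)" by simp
  have cpt: "compact ?K"
    by (intro compact_Int_closed closed_subspace W) simp
  obtain z where z: "z \<in> W" "z \<noteq> 0" using nz by blast
  have "(1 / norm z) *\<^sub>R z \<in> ?K"
    using z W by (auto simp: subspace_scale)
  then have ne: "?K \<noteq> {}" by blast
  have "continuous_on ?K ?\<phi>"
    by (intro continuous_intros linear_continuous_on_compose[OF _ lin]) 
  from continuous_attains_sup[OF cpt ne this] obtain x where
    x: "x \<in> W" "norm x = 1" and max: "\<And>y. y \<in> ?K \<Longrightarrow> ?\<phi> y \<le> ?\<phi> x" by auto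
  define l where "l = ?\<phi> x"
  have bound: "?\<phi> y \<le> l * (norm y)\<^sup>2" if "y \<in> W" for y
  proof (cases "y = 0")
    case False
    have "(1 / norm y) *\<^sub>R y \<in> ?K"
      using that False W by (auto simp: subspace_scale)
    from max[OF this] have "?\<phi> y / (norm y)\<^sup>2 \<le> l"
      by (simp add: mult_scaleR_vec l_def power2_eq_square)
    then show ?thesis using False by (simp add: field_simps)
  qed simp
  define v where "v = H *v x - l *\<^sub>R x"
  have vW: "v \<in> W" unfolding v_def
    by (intro subspace_diff W inv x subspace_scale)
  \<comment> \<open>First order condition: moving from the maximiser in the direction of the residual \<open>v\<close>
      would increase the quotient at rate \<open>2 |v|\<^sup>2\<close>.\<close>
  have key: "2 * e * (norm v)\<^sup>2 \<le> e\<^sup>2 * (l * (norm v)\<^sup>2 - ?\<phi> v)" for e :: real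
  proof -
    have "?\<phi> (x + e *\<^sub>R v) \<le> l * (norm (x + e *\<^sub>R v))\<^sup>2"
      by (intro bound subspace_add subspace_scale W x vW)
    moreover have "?\<phi> (x + e *\<^sub>R v) = ?\<phi> x + 2 * e * (v \<bullet> (H *v x)) + e\<^sup>2 * ?\<phi> v"
      using hermitian_inner[OF H, of v x]
      by (simp add: matrix_vector_right_distrib mult_scaleR_vec inner_add_left inner_add_right
          power2_eq_square algebra_simps inner_commute)
    moreover have "(norm (x + e *\<^sub>R v))\<^sup>2 = 1 + 2 * e * (v \<bullet> x) + e\<^sup>2 * (norm v)\<^sup>2"
      using x unfolding norm_eq_1 power2_norm_eq_inner
      by (simp add: inner_add_left inner_add_right power2_eq_square algebra_simps inner_commute)
    moreover have "v \<bullet> (H *v x) = (norm v)\<^sup>2 + l * (v \<bullet> x)"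
    proof -
      have "H *v x = v + l *\<^sub>R x" by (simp add: v_def)
      then show ?thesis by (simp add: inner_add_right power2_norm_eq_inner)
    qed
    moreover have "?\<phi> x = l" by (simp add: l_def)
    ultimately show ?thesis by (simp add: algebra_simps)
  qed
  have "v = 0"
  proof (rule ccontr)
    assume "v \<noteq> 0"
    then have pos: "(norm v)\<^sup>2 > 0" by simp
    define c where "c = \<bar>l * (norm v)\<^sup>2 - ?\<phi> v\<bar> + 1"
    have c: "c > 0" "l * (norm v)\<^sup>2 - ?\<phi> v \<le> c" by (auto simp: c_def)
    define e where "e = (norm v)\<^sup>2 / c"
    have e: "e > 0" using pos c by (simp add: e_def)
    have "2 * e * (norm v)\<^sup>2 \<le> e\<^sup>2 * c"
      using key[of e] mult_left_mono[OF c(2), of "e\<^sup>2"] by simp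
    also have "\<dots> = e * (norm v)\<^sup>2" using c by (simp add: e_def power2_eq_square)
    finally show False using e pos by simp
  qed
  then show ?thesis using x by (auto simp: v_def)
qed

text \<open>
  With the real inner product, complex orthogonality of \<open>x\<close> to \<open>u\<close> is the pair of conditions
  \<open>u \<bullet> x = 0\<close> and \<open>(\<i> u) \<bullet> x = 0\<close>. So \<open>k\<close> eigenvectors impose \<open>2 k\<close> real conditions in real dimension
  \<open>2 n\<close>, and for \<open>k < n\<close> their orthogonal complement still contains a further eigenvector.
\<close>
lemma hermitian_orthonormal_eigenvectors:
  fixes H :: "complex ^ 'n ^ 'n"
  assumes H: "hermitian H" and "k \<le> CARD('n)"
  shows "\<exists>(u :: nat \<Rightarrow> complex ^ 'n) l. (\<forall>i<k. norm (u i) = 1 \<and> H *v u i = l i *\<^sub>R u i) \<and>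
           (\<forall>i<k. \<forall>j<k. i \<noteq> j \<longrightarrow> u i \<bullet> u j = 0 \<and> (\<i> *s u i) \<bullet> u j = 0)"
  using assms(2)
proof (induction k)
  case (Suc k)
  then obtain u :: "nat \<Rightarrow> complex ^ 'n" and l where
    u: "\<And>i. i < k \<Longrightarrow> norm (u i) = 1" "\<And>i. i < k \<Longrightarrow> H *v u i = l i *\<^sub>R u i"
    and orth: "\<And>i j. i < k \<Longrightarrow> j < k \<Longrightarrow> i \<noteq> j \<Longrightarrow> u i \<bullet> u j = 0 \<and> (\<i> *s u i) \<bullet> u j = 0"
    by (metis Suc_leD)
  define W where "W = {x. \<forall>i<k. u i \<bullet> x = 0 \<and> (\<i> *s u i) \<bullet> x = 0}"
  have sub: "subspace W"
    by (auto simp: subspace_def W_def inner_add_right)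
  have inv: "H *v x \<in> W" if "x \<in> W" for x
  proof -
    have "u i \<bullet> (H *v x) = 0 \<and> (\<i> *s u i) \<bullet> (H *v x) = 0" if i: "i < k" for i
    proof -
      have "H *v (\<i> *s u i) = l i *\<^sub>R (\<i> *s u i)"
        by (simp add: mult_smult u[OF i]) (simp add: vec_eq_iff)
      then show ?thesis
        using \<open>x \<in> W\<close> i by (simp add: hermitian_inner[OF H, symmetric] u W_def)
    qed
    then show ?thesis by (simp add: W_def)
  qed
  let ?B = "u ` {..<k} \<union> (\<lambda>i. \<i> *s u i) ` {..<k}"
  have "dim (span ?B) \<le> card ?B" by (simp add: dim_le_card')
  also have "\<dots> \<le> card (u ` {..<k}) + card ((\<lambda>i. \<i> *s u i) ` {..<k})"
    by (rule card_Un_le)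
  also have "\<dots> \<le> k + k"
    by (intro add_mono order_trans[OF card_image_le]) auto
  also have "\<dots> < DIM(complex ^ 'n)" using Suc.prems by simp
  finally obtain x where x: "x \<noteq> 0" "\<And>y. y \<in> span (span ?B) \<Longrightarrow> orthogonal x y"
    using orthogonal_to_subspace_exists by blast
  have "x \<in> W"
    using x(2)[OF span_base[OF span_base]]
    by (simp add: W_def orthogonal_def inner_commute[of _ x])
  then obtain y m where y: "y \<in> W" "norm y = 1" "H *v y = m *\<^sub>R y"
    using hermitian_eigenvector_in_subspace[OF H sub inv] x(1) by blast
  have y1: "u i \<bullet> y = 0" "(\<i> *s u i) \<bullet> y = 0" if "i < k" for i
    using y(1) that by (auto simp: W_def)
  have y2: "y \<bullet> u i = 0" "(\<i> *s y) \<bullet> u i = 0" if "i < k" for i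
    using y1[OF that] smult_ii_inner[of y "u i"] by (metis inner_commute neg_0_equal_iff_equal)+
  have "(\<forall>i<Suc k. norm ((u(k := y)) i) = 1 \<and> H *v (u(k := y)) i = (l(k := m)) i *\<^sub>R (u(k := y)) i) \<and>
     (\<forall>i<Suc k. \<forall>j<Suc k. i \<noteq> j \<longrightarrow> (u(k := y)) i \<bullet> (u(k := y)) j = 0
         \<and> (\<i> *s (u(k := y)) i) \<bullet> (u(k := y)) j = 0)"
    using u orth y y1 y2 by (auto simp: less_Suc_eq)
  then show ?case by blast
qed auto

text \<open>
  For unitary \<open>S\<close> this is an eigendecomposition, for invertible \<open>S\<close> a diagonalisation by congruence;
  the latter is what a pair of positive definite matrices admits simultaneously.
\<close>
definition sandwich :: "complex ^ 'n ^ 'n \<Rightarrow> real ^ 'n \<Rightarrow> complex ^ 'n ^ 'n" where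
  "sandwich S d = S ** diag_mat d ** ctranspose S"

lemma mult_diag_mat_nth: "(S ** diag_mat d) $ i $ j = S $ i $ j * of_real (d $ j)"
  by (simp add: matrix_matrix_mult_def diag_mat_def if_distrib cong: if_cong)

lemma diag_mat_mult_nth: "(diag_mat d ** S) $ i $ j = of_real (d $ i) * S $ i $ j"
  by (simp add: matrix_matrix_mult_def diag_mat_def if_distrib[of "\<lambda>x. x * _"] cong: if_cong)

theorem hermitian_spectral:
  fixes H :: "complex ^ 'n ^ 'n"
  assumes "hermitian H"
  obtains U d where "unitary U" "H = sandwich U d"
proof -
  obtain u :: "nat \<Rightarrow> complex ^ 'n" and l where
    ev: "\<forall>i<CARD('n). norm (u i) = 1 \<and> H *v u i = l i *\<^sub>R u i"
    and orth: "\<forall>i<CARD('n). \<forall>j<CARD('n). i \<noteq> j \<longrightarrow> u i \<bullet> u j = 0 \<and> (\<i> *s u i) \<bullet> u j = 0"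
    using hermitian_orthonormal_eigenvectors[OF assms order_refl] by (elim exE conjE) 
  have u: "\<And>i. i < CARD('n) \<Longrightarrow> norm (u i) = 1" "\<And>i. i < CARD('n) \<Longrightarrow> H *v u i = l i *\<^sub>R u i"
    using ev by auto
  obtain g :: "'n \<Rightarrow> nat" where g: "bij_betw g UNIV {0..<CARD('n)}"
    using ex_bij_betw_finite_nat[of "UNIV :: 'n set"] by auto
  have gless: "g i < CARD('n)" for i using g by (auto simp: bij_betw_def)
  have ginj: "g i = g j \<longleftrightarrow> i = j" for i j using g by (auto simp: bij_betw_def inj_eq)
  define U :: "complex ^ 'n ^ 'n" where "U = (\<chi> a b. u (g b) $ a)"
  define d :: "real ^ 'n" where "d = (\<chi> b. l (g b))"
  have *: "(ctranspose U ** U) $ i $ j = Complex (u (g i) \<bullet> u (g j)) ((\<i> *s u (g i)) \<bullet> u (g j))" for i j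
    by (simp add: complex_eq_iff matrix_matrix_mult_def ctranspose_def U_def inner_vec_def
        inner_complex_def Re_sum Im_sum algebra_simps)
  have ii0: "(\<i> *s x) \<bullet> x = 0" for x :: "complex ^ 'n"
    using smult_ii_inner[of x x] by (simp add: inner_commute)
  have "ctranspose U ** U = mat 1"
    using orth gless u(1)[OF gless] ii0
    by (auto simp: vec_eq_iff * mat_def ginj complex_eq_iff norm_eq_1)
  then have U: "unitary U"
    by (simp add: unitary_def matrix_left_right_inverse)
  have "(H ** U) $ i $ j = (H *v u (g j)) $ i" for i j
    by (simp add: matrix_matrix_mult_def matrix_vector_mult_def U_def)
  then have "H ** U = U ** diag_mat d"
    by (simp add: vec_eq_iff u(2)[OF gless] mult_diag_mat_nth)
       (simp add: U_def d_def scaleR_conv_of_real)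
  then have "sandwich U d = H ** (U ** ctranspose U)"
    by (simp add: sandwich_def matrix_mul_assoc)
  then have "H = sandwich U d" using U by (simp add: unitary_def)
  then show ?thesis using U that by blast
qed

section \<open>Functional calculus\<close>

lemma unitaryD:
  assumes "unitary U"
  shows "ctranspose U ** U = mat 1" "U ** ctranspose U = mat 1"
  using assms by (auto simp: unitary_def)

lemma unitary_mult: "unitary U \<Longrightarrow> unitary V \<Longrightarrow> unitary (U ** V)"
  by (simp add: unitary_def ctranspose_mult) (metis matrix_mul_assoc matrix_mul_lid)

lemma unitary_ctranspose: "unitary U \<Longrightarrow> unitary (ctranspose U)"
  by (simp add: unitary_def)

lemma unitary_mat_1: "unitary (mat 1)"
  by (simp add: unitary_def)

lemma diag_mat_mult: "diag_mat d ** diag_mat e = diag_mat (\<chi> i. d $ i * e $ i)"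
  by (simp add: vec_eq_iff diag_mat_mult_nth) (simp add: diag_mat_def)

lemma diag_mat_ones [simp]: "diag_mat (\<chi> i. 1) = mat 1"
  by (simp add: diag_mat_def mat_def vec_eq_iff)

lemma diag_mat_add: "diag_mat d + diag_mat e = diag_mat (\<chi> i. d $ i + e $ i)"
  by (simp add: diag_mat_def vec_eq_iff)

lemma diag_mat_scaleR: "diag_mat (\<chi> i. c * d $ i) = c *\<^sub>R diag_mat d"
  by (simp add: diag_mat_def vec_eq_iff) (simp add: scaleR_conv_of_real)

lemma sandwich_ones: "sandwich S (\<chi> i. 1) = S ** ctranspose S"
  by (simp add: sandwich_def)

lemma sandwich_scale: "sandwich S (\<chi> i. c * d $ i) = c *\<^sub>R sandwich S d"
  by (simp add: sandwich_def diag_mat_scaleR matrix_scalar_ac scalar_matrix_assoc)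

lemma sandwich_scaleR: "sandwich (a *\<^sub>R S) d = (a * a) *\<^sub>R sandwich S d"
  by (simp add: sandwich_def matrix_scalar_ac flip: scalar_matrix_assoc)

lemma sandwich_congruence: "M ** sandwich S d ** ctranspose M = sandwich (M ** S) d"
  by (simp add: sandwich_def ctranspose_mult matrix_mul_assoc)

lemma sandwich_mult_diag_mat:
  "sandwich (S ** diag_mat e) d = sandwich S (\<chi> i. e $ i * d $ i * e $ i)"
proof -
  have "sandwich (S ** diag_mat e) d
      = S ** (diag_mat e ** diag_mat d ** diag_mat e) ** ctranspose S"
    by (simp add: sandwich_def ctranspose_mult matrix_mul_assoc)
  then show ?thesis by (simp add: diag_mat_mult sandwich_def)
qed

lemma sandwich_mult_sandwich:
  assumes "unitary U"
  shows "sandwich U d ** sandwich U e = sandwich U (\<chi> i. d $ i * e $ i)"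
proof -
  have "sandwich U d ** sandwich U e
      = U ** diag_mat d ** (ctranspose U ** U) ** diag_mat e ** ctranspose U"
    by (simp add: sandwich_def matrix_mul_assoc)
  also have "\<dots> = U ** (diag_mat d ** diag_mat e) ** ctranspose U"
    by (simp add: unitaryD[OF assms] matrix_mul_assoc)
  finally show ?thesis by (simp add: diag_mat_mult sandwich_def)
qed

lemma hermitian_sandwich [simp]: "hermitian (sandwich S d)"
  by (simp add: hermitian_def sandwich_def ctranspose_mult matrix_mul_assoc)

lemma hermitian_scaleR: "hermitian A \<Longrightarrow> hermitian (c *\<^sub>R A)"
  by (simp add: hermitian_def)

lemma hermitian_sum: "(\<And>j. j \<in> J \<Longrightarrow> hermitian (f j)) \<Longrightarrow> hermitian (sum f J)"
  by (simp add: hermitian_def ctranspose_sum)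

lemma inner_sandwich:
  "x \<bullet> (sandwich S d *v x) = (\<Sum>k\<in>UNIV. d $ k * (cmod ((ctranspose S *v x) $ k))\<^sup>2)"
proof -
  have "x \<bullet> (sandwich S d *v x) = (ctranspose S *v x) \<bullet> (diag_mat d *v (ctranspose S *v x))"
    by (simp add: sandwich_def inner_ctranspose flip: matrix_vector_mul_assoc)
  also have "diag_mat d *v y = (\<chi> k. d $ k *\<^sub>R y $ k)" for y
    by (simp add: vec_eq_iff diag_mat_def matrix_vector_mult_def if_distrib[of "\<lambda>x. x * _"]
        scaleR_conv_of_real cong: if_cong)
  finally show ?thesis
    by (simp add: inner_vec_def power2_norm_eq_inner)
qed

lemma trace_sandwich:
  assumes "unitary U"
  shows "trace (sandwich U d) = of_real (\<Sum>i\<in>UNIV. d $ i)"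
proof -
  have "trace (sandwich U d) = trace (ctranspose U ** (U ** diag_mat d))"
    unfolding sandwich_def by (rule trace_mul_sym)
  also have "\<dots> = trace (diag_mat d)"
    by (simp add: matrix_mul_assoc unitaryD[OF assms])
  finally show ?thesis by (simp add: trace_def diag_mat_def)
qed

text \<open>
  If \<open>U diag(d) U\<^sup>* = V diag(e) V\<^sup>*\<close>, then \<open>W = V\<^sup>* U\<close> intertwines \<open>diag(d)\<close> and \<open>diag(e)\<close>, so each
  nonzero entry \<open>W\<^sub>i\<^sub>j\<close> forces \<open>d\<^sub>j = e\<^sub>i\<close>; hence \<open>W\<close> also intertwines \<open>diag(f(d))\<close> and \<open>diag(f(e))\<close>.
\<close>
lemma sandwich_functional_calculus_unique:
  assumes U: "unitary U" and V: "unitary V" and eq: "sandwich U d = sandwich V e"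
  shows "sandwich U (\<chi> i. f (d $ i)) = sandwich V (\<chi> i. f (e $ i))"
proof -
  define W where "W = ctranspose V ** U"
  have "W ** diag_mat d = ctranspose V ** sandwich U d ** U"
  proof -
    have "ctranspose V ** sandwich U d ** U
        = ctranspose V ** U ** diag_mat d ** (ctranspose U ** U)"
      by (simp add: sandwich_def matrix_mul_assoc)
    then show ?thesis by (simp add: W_def unitaryD[OF U])
  qed
  also have "\<dots> = (ctranspose V ** V) ** diag_mat e ** W"
    by (simp only: eq) (simp add: sandwich_def matrix_mul_assoc W_def)
  finally have "W ** diag_mat d = diag_mat e ** W" by (simp add: unitaryD[OF V])
  then have "W $ i $ j * of_real (d $ j) = of_real (e $ i) * W $ i $ j" for i j
    by (metis mult_diag_mat_nth diag_mat_mult_nth)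
  then have "W $ i $ j * of_real (f (d $ j)) = of_real (f (e $ i)) * W $ i $ j" for i j
    by (metis mult.commute mult_cancel_right of_real_eq_iff)
  then have tw: "W ** diag_mat (\<chi> i. f (d $ i)) = diag_mat (\<chi> i. f (e $ i)) ** W"
    by (simp add: vec_eq_iff mult_diag_mat_nth diag_mat_mult_nth)
  have VW: "V ** W = U"
    by (simp add: W_def matrix_mul_assoc unitaryD[OF V])
  have "sandwich U (\<chi> i. f (d $ i)) = V ** (W ** diag_mat (\<chi> i. f (d $ i))) ** ctranspose U"
    by (simp add: sandwich_def matrix_mul_assoc VW)
  also have "\<dots> = V ** diag_mat (\<chi> i. f (e $ i)) ** (ctranspose V ** (U ** ctranspose U))"
    by (simp only: tw) (simp add: matrix_mul_assoc W_def)
  finally show ?thesis by (simp add: sandwich_def unitaryD[OF U])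
qed

lemma mat_fun_sandwich:
  assumes "unitary U"
  shows "mat_fun f (sandwich U d) = sandwich U (\<chi> i. f (d $ i))"
  unfolding mat_fun_def sandwich_def[symmetric]
proof (rule the_equality)
  show "\<exists>Ua da. unitary Ua \<and> sandwich U d = sandwich Ua da \<and>
      sandwich U (\<chi> i. f (d $ i)) = sandwich Ua (\<chi> i. f (da $ i))"
    using assms by blast
next
  fix B
  assume "\<exists>Ua da. unitary Ua \<and> sandwich U d = sandwich Ua da \<and> B = sandwich Ua (\<chi> i. f (da $ i))"
  then show "B = sandwich U (\<chi> i. f (d $ i))"
    using sandwich_functional_calculus_unique[OF assms] by metis
qed

lemma mat_powr_sandwich:
  "unitary U \<Longrightarrow> mat_powr (sandwich U d) t = sandwich U (\<chi> i. d $ i powr t)"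
  by (simp add: mat_powr_def mat_fun_sandwich)

section \<open>Positive definite matrices\<close>

lemma inner_smult_smult: "(a *s x) \<bullet> (b *s x) = Re (a * cnj b) * (norm x)\<^sup>2" for x :: "complex ^ 'n"
  by (simp add: inner_vec_def inner_complex_def power2_norm_eq_inner sum_distrib_left algebra_simps)

lemma matrix_inv_eqI:
  fixes A :: "'a::field ^ 'n ^ 'n"
  assumes "A ** B = mat 1"
  shows "matrix_inv A = B"
proof -
  have BA: "B ** A = mat 1" using assms by (simp add: matrix_left_right_inverse)
  have "\<exists>A'. A ** A' = mat 1 \<and> A' ** A = mat 1" using assms BA by blast
  then have "A ** matrix_inv A = mat 1 \<and> matrix_inv A ** A = mat 1"
    unfolding matrix_inv_def by (rule someI_ex)
  then have inv: "A ** matrix_inv A = mat 1" by blast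
  have "matrix_inv A = (B ** A) ** matrix_inv A" by (simp add: BA)
  also have "\<dots> = B" by (simp add: inv flip: matrix_mul_assoc)
  finally show ?thesis .
qed

lemma matrix_inv_mult:
  fixes A :: "'a::field ^ 'n ^ 'n"
  assumes "invertible A"
  shows "A ** matrix_inv A = mat 1" "matrix_inv A ** A = mat 1"
  using assms matrix_inv_eqI[of A] unfolding invertible_def by metis+

lemma unitary_invertible: "unitary U \<Longrightarrow> invertible U"
  unfolding unitary_def invertible_def by blast

lemma invertible_matrix_mult:
  fixes A B :: "'a::field ^ 'n ^ 'n"
  assumes "invertible A" "invertible B"
  shows "invertible (A ** B)"
proof -
  have "(A ** B) ** (matrix_inv B ** matrix_inv A)
      = A ** (B ** matrix_inv B) ** matrix_inv A"
    by (simp only: matrix_mul_assoc)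
  then have "(A ** B) ** (matrix_inv B ** matrix_inv A) = mat 1"
    by (simp add: matrix_inv_mult assms)
  then show ?thesis unfolding invertible_right_inverse by blast
qed

lemma invertible_ctranspose: "invertible S \<Longrightarrow> invertible (ctranspose S)"
  unfolding invertible_def by (metis ctranspose_mult ctranspose_mat_1)

lemma invertible_mult_vec_nonzero:
  fixes A :: "'a::field ^ 'n ^ 'n"
  assumes "invertible A" "x \<noteq> 0"
  shows "A *v x \<noteq> 0"
  by (metis assms matrix_inv_mult(2) matrix_vector_mul_assoc matrix_vector_mul_lid
      matrix_vector_mult_0_right)

lemma inner_sandwich_pos:
  assumes "invertible S" "\<And>i. d $ i > 0" "x \<noteq> 0"
  shows "x \<bullet> (sandwich S d *v x) > 0"
proof -
  have "ctranspose S *v x \<noteq> 0"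
    by (intro invertible_mult_vec_nonzero invertible_ctranspose assms)
  then obtain k where "(ctranspose S *v x) $ k \<noteq> 0" by (auto simp: vec_eq_iff)
  then show ?thesis unfolding inner_sandwich
    by (intro sum_pos2[of _ k]) (use assms(2) in \<open>auto simp: less_imp_le\<close>)
qed

text \<open>
  The columns of the unitary matrix in a spectral decomposition are eigenvectors, so the eigenvalue
  condition controls the quadratic form; conversely an eigenvector evaluates the form at its eigenvalue.
\<close>
lemma pos_def_iff: "pos_def A \<longleftrightarrow> hermitian A \<and> (\<forall>x. x \<noteq> 0 \<longrightarrow> x \<bullet> (A *v x) > 0)"
proof (intro iffI conjI; (elim conjE)?)
  assume A: "pos_def A"
  then show H: "hermitian A" by (simp add: pos_def_def)
  then obtain U d where U: "unitary U" "A = sandwich U d" by (rule hermitian_spectral)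
  have "d $ i > 0" for i
  proof -
    have "ctranspose U *v (U *v axis i 1) = axis i (1::complex)"
      by (simp add: matrix_vector_mul_assoc unitaryD[OF U(1)])
    then have "A *v (U *v axis i 1) = U *v (diag_mat d *v axis i 1)"
      by (simp add: U(2) sandwich_def flip: matrix_vector_mul_assoc)
    also have "diag_mat d *v axis i 1 = of_real (d $ i) *s axis i (1::complex)"
      by (simp add: vec_eq_iff matrix_vector_mult_def diag_mat_def axis_def if_distrib[of "\<lambda>x. _ * x"]
          cong: if_cong)
    finally have "A *v (U *v axis i 1) = of_real (d $ i) *s (U *v axis i 1)"
      by (simp add: mult_smult)
    moreover have "U *v axis i (1::complex) \<noteq> 0"
      by (intro invertible_mult_vec_nonzero unitary_invertible U) (simp add: axis_eq_0_iff)
    ultimately have "eigenvalue A (of_real (d $ i))" unfolding eigenvalue_def by blast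
    then show ?thesis using A by (auto simp: pos_def_def)
  qed
  then show "\<forall>x. x \<noteq> 0 \<longrightarrow> x \<bullet> (A *v x) > 0"
    using U by (simp add: inner_sandwich_pos unitary_invertible)
next
  assume H: "hermitian A" and pos: "\<forall>x. x \<noteq> 0 \<longrightarrow> x \<bullet> (A *v x) > 0"
  have "c \<in> \<real> \<and> 0 < Re c" if ev: "eigenvalue A c" for c
  proof -
    obtain x where x: "x \<noteq> 0" "A *v x = c *s x" using ev by (auto simp: eigenvalue_def)
    have "Re c > 0"
      using pos[rule_format, of x] x inner_smult_smult[of 1 x c] by (simp add: zero_less_mult_iff)
    moreover have "x \<bullet> (A *v (\<i> *s x)) = (A *v x) \<bullet> (\<i> *s x)"
      by (simp only: hermitian_inner[OF H])
    then have "(1 *s x) \<bullet> ((\<i> * c) *s x) = (c *s x) \<bullet> (\<i> *s x)"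
      by (simp add: mult_smult x vector_smult_assoc)
    then have "Im c = 0" using x(1) unfolding inner_smult_smult by simp
    ultimately show ?thesis by (simp add: complex_is_Real_iff)
  qed
  then show "pos_def A" using H by (simp add: pos_def_def)
qed

lemma pos_def_hermitian: "pos_def A \<Longrightarrow> hermitian A"
  by (simp add: pos_def_def)

lemma pos_def_sandwich: "invertible S \<Longrightarrow> (\<And>i. d $ i > 0) \<Longrightarrow> pos_def (sandwich S d)"
  by (simp add: pos_def_iff inner_sandwich_pos)

lemma pos_def_sandwich_powr:
  "invertible S \<Longrightarrow> (\<And>i. d $ i > 0) \<Longrightarrow> pos_def (sandwich S (\<chi> i. d $ i powr t))"
  by (rule pos_def_sandwich) (simp_all add: less_imp_neq[THEN not_sym])

lemma inner_sandwich_column: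
  assumes U: "unitary U"
  shows "(U *v axis i 1) \<bullet> (sandwich U d *v (U *v axis i 1)) = d $ i"
proof -
  have "ctranspose U *v (U *v axis i 1) = axis i (1::complex)"
    by (simp add: matrix_vector_mul_assoc unitaryD[OF U])
  then show ?thesis
    by (simp add: inner_sandwich axis_def if_distrib[of cmod] if_distrib[of "\<lambda>x. x ^ 2"]
        if_distrib[of "\<lambda>x. _ * x"] cong: if_cong)
qed

lemma sandwich_pos_def_eigenvalue_pos:
  assumes U: "unitary U" and A: "pos_def (sandwich U d)"
  shows "d $ i > 0"
proof -
  have "U *v axis i (1::complex) \<noteq> 0"
    by (intro invertible_mult_vec_nonzero unitary_invertible U) (simp add: axis_eq_0_iff)
  then show ?thesis
    using A unfolding pos_def_iff by (metis inner_sandwich_column[OF U])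
qed

lemma pos_def_spectral:
  assumes "pos_def A"
  obtains U d where "unitary U" "\<forall>i. d $ i > 0" "A = sandwich U d"
  by (metis assms hermitian_spectral pos_def_hermitian sandwich_pos_def_eigenvalue_pos)

lemma pos_def_scaleR: "pos_def A \<Longrightarrow> c > 0 \<Longrightarrow> pos_def (c *\<^sub>R A)"
  by (simp add: pos_def_iff hermitian_scaleR mult_vec_scaleR)

lemma pos_def_mat_1: "pos_def (mat 1)"
  by (simp add: pos_def_iff hermitian_def)

lemma pos_def_sum:
  assumes "finite J" "J \<noteq> {}" "\<And>j. j \<in> J \<Longrightarrow> pos_def (f j)"
  shows "pos_def (sum f J)"
  using assms by (simp add: pos_def_iff hermitian_sum mult_vec_sum inner_sum_right sum_pos)

lemma pos_def_congruence:
  fixes S :: "complex ^ 'n ^ 'n"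
  assumes A: "pos_def A" and S: "invertible S"
  shows "pos_def (S ** A ** ctranspose S)"
proof -
  obtain U d where U: "unitary U" "\<forall>i. d $ i > 0" "A = sandwich U d"
    using A by (rule pos_def_spectral)
  have "invertible (S ** U)"
    by (intro invertible_matrix_mult S unitary_invertible U)
  then show ?thesis
    using U(2) by (simp add: U(3) sandwich_congruence pos_def_sandwich)
qed

lemma matrix_inv_sandwich:
  assumes S: "invertible S" and d: "\<And>i. d $ i \<noteq> 0"
  shows "matrix_inv (sandwich S d) = sandwich (ctranspose (matrix_inv S)) (\<chi> i. inverse (d $ i))"
proof (rule matrix_inv_eqI)
  let ?T = "matrix_inv S" and ?e = "\<chi> i. inverse (d $ i)"
  have "ctranspose S ** ctranspose ?T = mat 1"
    by (simp add: matrix_inv_mult[OF S] flip: ctranspose_mult)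
  moreover have "diag_mat d ** diag_mat ?e = mat 1"
    by (simp add: diag_mat_mult d)
  moreover have "sandwich S d ** sandwich (ctranspose ?T) ?e =
      S ** (diag_mat d ** ((ctranspose S ** ctranspose ?T) ** diag_mat ?e)) ** ?T"
    by (simp add: sandwich_def matrix_mul_assoc)
  ultimately show "sandwich S d ** sandwich (ctranspose ?T) ?e = mat 1"
    by (simp add: matrix_inv_mult[OF S])
qed

lemma matrix_inv_unitary: "unitary U \<Longrightarrow> matrix_inv U = ctranspose U"
  by (intro matrix_inv_eqI unitaryD)

lemma matrix_inv_sandwich_unitary:
  "unitary U \<Longrightarrow> (\<And>i. d $ i \<noteq> 0) \<Longrightarrow>
    matrix_inv (sandwich U d) = sandwich U (\<chi> i. inverse (d $ i))"
  by (simp add: matrix_inv_sandwich unitary_invertible matrix_inv_unitary)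

lemma pos_def_matrix_inv: "pos_def A \<Longrightarrow> pos_def (matrix_inv A)"
  by (rule pos_def_spectral, assumption)
     (simp add: matrix_inv_sandwich_unitary less_imp_neq[THEN not_sym] pos_def_sandwich unitary_invertible)

lemma pos_def_invertible: 
  assumes "pos_def A" shows "invertible A"
proof -
  have "inj ((*v) A)"
  proof (rule injI)
    fix x y assume "A *v x = A *v y"
    then have "A *v (x - y) = 0" by (simp add: matrix_vector_mult_diff_distrib)
    then have "x - y = 0" using assms unfolding pos_def_iff by (metis inner_zero_right less_irrefl)
    then show "x = y" by simp
  qed
  then show ?thesis
    using matrix_left_invertible_injective invertible_left_inverse by blast
qed

lemma matrix_inv_matrix_inv:
  fixes A :: "'a::field ^ 'n ^ 'n"
  shows "invertible A \<Longrightarrow> matrix_inv (matrix_inv A) = A"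
  by (intro matrix_inv_eqI matrix_inv_mult)

lemma pos_def_mat_powr: "pos_def A \<Longrightarrow> pos_def (mat_powr A t)"
  by (rule pos_def_spectral, assumption)
     (simp add: mat_powr_sandwich pos_def_sandwich_powr unitary_invertible)

lemma mat_powr_mult: "pos_def A \<Longrightarrow> mat_powr A s ** mat_powr A t = mat_powr A (s + t)"
  by (rule pos_def_spectral, assumption)
     (simp add: mat_powr_sandwich sandwich_mult_sandwich powr_add)

lemma mat_powr_0: "pos_def A \<Longrightarrow> mat_powr A 0 = mat 1"
  by (rule pos_def_spectral, assumption)
     (simp add: mat_powr_sandwich less_imp_neq[THEN not_sym] sandwich_ones unitaryD)

lemma mat_powr_1: "pos_def A \<Longrightarrow> mat_powr A 1 = A"
  by (rule pos_def_spectral, assumption) (simp add: mat_powr_sandwich less_imp_le)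

lemma mat_powr_matrix_inv: "pos_def A \<Longrightarrow> mat_powr (matrix_inv A) t = mat_powr A (- t)"
  by (rule pos_def_spectral, assumption)
     (simp add: mat_powr_sandwich less_imp_neq[THEN not_sym] less_imp_le matrix_inv_sandwich_unitary
        powr_minus inverse_powr)

lemma schatten_pos_def:
  assumes "pos_def A"
  shows "schatten q A = Re (trace (mat_powr A q)) powr (1 / q)"
proof -
  obtain U d where U: "unitary U" "\<forall>i. d $ i > 0" "A = sandwich U d"
    using assms by (rule pos_def_spectral)
  have "ctranspose A ** A = sandwich U (\<chi> i. d $ i * d $ i)"
    using pos_def_hermitian[OF assms] U by (simp add: hermitian_def sandwich_mult_sandwich)
  then have "mat_abs A = sandwich U (\<chi> i. (d $ i * d $ i) powr (1/2))"
    by (simp add: mat_abs_def mat_powr_sandwich U)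
  also have "\<dots> = A"
    using U by (simp add: powr_half_sqrt less_imp_le)
  finally show ?thesis by (simp add: schatten_def)
qed

section \<open>The weighted geometric mean\<close>

text \<open>
  Any two positive definite matrices can be diagonalised by the same congruence \<open>S\<close>, one of them to
  the identity. In such coordinates the geometric mean is just \<open>\<mu> \<mapsto> \<mu>\<^sup>t\<close>, whatever \<open>S\<close> is; all
  algebraic properties of the mean are read off from this.
\<close>
lemma pos_def_simultaneous_congruence:
  assumes A: "pos_def A" and B: "pos_def B"
  obtains S \<mu> where "invertible S" "\<forall>i. \<mu> $ i > 0" "A = S ** ctranspose S" "B = sandwich S \<mu>"
proof -
  define R Q where R_def: "R = mat_powr A (1/2)" and Q_def: "Q = mat_powr A (-1/2)"
  have R: "pos_def R" and Q: "pos_def Q"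
    using A by (auto simp: R_def Q_def intro: pos_def_mat_powr)
  have cR: "ctranspose R = R" and cQ: "ctranspose Q = Q"
    using pos_def_hermitian R Q by (auto simp: hermitian_def)
  have RQ: "R ** Q = mat 1" "Q ** R = mat 1" and RR: "R ** R = A"
    using A by (simp_all add: R_def Q_def mat_powr_mult mat_powr_0 mat_powr_1)
  have "pos_def (Q ** B ** ctranspose Q)"
    using B Q by (intro pos_def_congruence pos_def_invertible)
  then obtain U d where U: "unitary U" "\<forall>i. d $ i > 0" "Q ** B ** Q = sandwich U d"
    unfolding cQ using pos_def_spectral by metis
  have "(R ** U) ** ctranspose (R ** U) = R ** (U ** ctranspose U) ** R"
    by (simp add: ctranspose_mult cR matrix_mul_assoc)
  then have 1: "A = (R ** U) ** ctranspose (R ** U)" by (simp add: unitaryD[OF U(1)] RR)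
  have "sandwich (R ** U) d = R ** (Q ** B ** Q) ** R"
    using U(3) by (simp add: cR flip: sandwich_congruence)
  also have "\<dots> = (R ** Q) ** B ** (Q ** R)" by (simp add: matrix_mul_assoc)
  finally have 2: "B = sandwich (R ** U) d" by (simp add: RQ)
  have "invertible (R ** U)"
    using R U by (intro invertible_matrix_mult pos_def_invertible unitary_invertible)
  from that[OF this U(2) 1 2] show ?thesis .
qed

lemma geo_mean_congruence_form:
  assumes S: "invertible S" and \<mu>: "\<And>i. \<mu> $ i > 0"
  shows "geo_mean t (S ** ctranspose S) (sandwich S \<mu>) = sandwich S (\<chi> i. \<mu> $ i powr t)"
proof -
  define A where "A = S ** ctranspose S"
  have A: "pos_def A"
    using pos_def_sandwich[OF S, of "\<chi> i. 1"] by (simp add: sandwich_ones A_def)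
  define R Q where R_def: "R = mat_powr A (1/2)" and Q_def: "Q = mat_powr A (-1/2)"
  have R: "pos_def R" and Q: "pos_def Q"
    using A by (auto simp: R_def Q_def intro: pos_def_mat_powr)
  have cR: "ctranspose R = R" and cQ: "ctranspose Q = Q"
    using pos_def_hermitian R Q by (auto simp: hermitian_def)
  have RQ: "R ** Q = mat 1" "Q ** R = mat 1" and RR: "R ** R = A"
    using A by (simp_all add: R_def Q_def mat_powr_mult mat_powr_0 mat_powr_1)
  define V where "V = Q ** S"
  have RV: "R ** V = S" by (simp add: V_def matrix_mul_assoc RQ)
  have "V ** ctranspose V = Q ** A ** Q"
    by (simp add: V_def A_def ctranspose_mult cQ matrix_mul_assoc)
  also have "\<dots> = (Q ** R) ** (R ** Q)" by (simp add: matrix_mul_assoc flip: RR)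
  finally have "V ** ctranspose V = mat 1" by (simp add: RQ)
  then have V: "unitary V" by (simp add: unitary_def matrix_left_right_inverse)
  have "Q ** sandwich S \<mu> ** Q = sandwich V \<mu>"
    using sandwich_congruence[of Q S \<mu>] by (simp add: cQ V_def)
  then have "geo_mean t A (sandwich S \<mu>) = R ** sandwich V (\<chi> i. \<mu> $ i powr t) ** ctranspose R"
    unfolding geo_mean_def R_def[symmetric] Q_def[symmetric] by (simp add: mat_powr_sandwich[OF V] cR)
  then show ?thesis by (simp add: sandwich_congruence RV A_def)
qed

lemma pos_def_geo_mean:
  assumes "pos_def A" "pos_def B"
  shows "pos_def (geo_mean t A B)"
proof -
  obtain S \<mu> where S: "invertible S" "\<forall>i. \<mu> $ i > 0" "A = S ** ctranspose S" "B = sandwich S \<mu>"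
    using assms by (rule pos_def_simultaneous_congruence)
  then show ?thesis by (simp add: geo_mean_congruence_form pos_def_sandwich_powr)
qed

text \<open>
  If \<open>A = S S\<^sup>*\<close> and \<open>B = S diag(\<mu>) S\<^sup>*\<close>, then \<open>T = S diag(\<surd>\<mu>)\<close> satisfies \<open>B = T T\<^sup>*\<close> and
  \<open>A = T diag(1/\<mu>) T\<^sup>*\<close>: rescaling the congruence exchanges the roles of the two matrices.
\<close>
lemma geo_mean_commute:
  assumes "pos_def A" "pos_def B"
  shows "geo_mean t A B = geo_mean (1 - t) B A"
proof -
  obtain S \<mu> where S: "invertible S" "\<forall>i. \<mu> $ i > 0" "A = S ** ctranspose S" "B = sandwich S \<mu>"
    using assms by (rule pos_def_simultaneous_congruence)
  define T where "T = S ** diag_mat (\<chi> i. sqrt (\<mu> $ i))"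
  have nz: "\<mu> $ i \<noteq> 0" for i using S(2)[rule_format, of i] by simp
  have "pos_def (sandwich (mat 1) (\<chi> i. sqrt (\<mu> $ i)))"
    using S by (intro pos_def_sandwich unitary_invertible unitary_mat_1) auto
  then have T: "invertible T" unfolding T_def
    by (intro invertible_matrix_mult S pos_def_invertible) (simp add: sandwich_def)
  have 1: "T ** ctranspose T = B"
    using S by (simp add: T_def sandwich_mult_diag_mat less_imp_le flip: sandwich_ones)
  have 2: "sandwich T (\<chi> i. inverse (\<mu> $ i)) = A"
    using S nz by (simp add: T_def sandwich_mult_diag_mat less_imp_le field_simps
        flip: sandwich_ones)
  have 3: "sqrt (\<mu> $ i) * inverse (\<mu> $ i) powr (1 - t) * sqrt (\<mu> $ i) = \<mu> $ i powr t" for i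
  proof -
    have "sqrt (\<mu> $ i) * inverse (\<mu> $ i) powr (1 - t) * sqrt (\<mu> $ i)
        = (sqrt (\<mu> $ i) * sqrt (\<mu> $ i)) * inverse (\<mu> $ i) powr (1 - t)" by simp
    also have "\<dots> = \<mu> $ i powr 1 * \<mu> $ i powr (t - 1)"
      using S(2)[rule_format, of i] by (simp add: inverse_powr flip: powr_minus)
    also have "\<dots> = \<mu> $ i powr t" by (subst powr_add[symmetric]) simp
    finally show ?thesis .
  qed
  have "geo_mean (1 - t) B A = sandwich T (\<chi> i. inverse (\<mu> $ i) powr (1 - t))"
    using geo_mean_congruence_form[OF T, of "\<chi> i. inverse (\<mu> $ i)" "1 - t"] S by (simp add: 1 2)
  also have "\<dots> = sandwich S (\<chi> i. \<mu> $ i powr t)"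
    by (simp add: T_def sandwich_mult_diag_mat 3)
  finally show ?thesis using S by (simp add: geo_mean_congruence_form)
qed

lemma geo_mean_scale_left:
  assumes "pos_def A" "pos_def B" "c > 0"
  shows "geo_mean t (c *\<^sub>R A) B = c powr (1 - t) *\<^sub>R geo_mean t A B"
proof -
  obtain S \<mu> where S: "invertible S" "\<forall>i. \<mu> $ i > 0" "A = S ** ctranspose S" "B = sandwich S \<mu>"
    using assms(1,2) by (rule pos_def_simultaneous_congruence)
  define T where "T = sqrt c *\<^sub>R S"
  have T: "invertible T"
    using S(1) \<open>c > 0\<close> unfolding T_def by (simp add: scalar_invertible)
  have 1: "T ** ctranspose T = c *\<^sub>R A"
    using S(3) \<open>c > 0\<close> unfolding T_def sandwich_ones[symmetric] sandwich_scaleR by simp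
  have 2: "sandwich T (\<chi> i. (1 / c) * \<mu> $ i) = B"
    unfolding sandwich_scale using S \<open>c > 0\<close> by (simp add: T_def sandwich_scaleR)
  have "geo_mean t (c *\<^sub>R A) B = sandwich T (\<chi> i. (1 / c * \<mu> $ i) powr t)"
    using geo_mean_congruence_form[OF T, of "\<chi> i. (1 / c) * \<mu> $ i" t] S(2) \<open>c > 0\<close>
    unfolding 1 2 by simp
  also have "\<dots> = sandwich T (\<chi> i. (1 / c) powr t * (\<chi> i. \<mu> $ i powr t) $ i)"
    using S(2) \<open>c > 0\<close> by (simp only: powr_mult vec_lambda_beta)
  also have "\<dots> = (c * (1 / c) powr t) *\<^sub>R sandwich S (\<chi> i. \<mu> $ i powr t)"
    unfolding sandwich_scale using \<open>c > 0\<close> by (simp add: T_def sandwich_scaleR)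
  also have "c * (1 / c) powr t = c powr (1 - t)"
    using \<open>c > 0\<close> by (simp add: powr_diff powr_divide)
  finally show ?thesis using S by (simp add: geo_mean_congruence_form)
qed

lemma matrix_inv_geo_mean:
  assumes "pos_def A" "pos_def B"
  shows "matrix_inv (geo_mean t A B) = geo_mean t (matrix_inv A) (matrix_inv B)"
proof -
  obtain S \<mu> where S: "invertible S" "\<forall>i. \<mu> $ i > 0" "A = S ** ctranspose S" "B = sandwich S \<mu>"
    using assms by (rule pos_def_simultaneous_congruence)
  define T where "T = ctranspose (matrix_inv S)"
  have nz: "\<mu> $ i \<noteq> 0" for i using S(2)[rule_format, of i] by simp
  have "invertible (matrix_inv S)"
    using matrix_inv_mult[OF S(1)] unfolding invertible_def by blast
  then have T: "invertible T" by (simp add: T_def invertible_ctranspose)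
  have "matrix_inv A = T ** ctranspose T"
    using matrix_inv_sandwich[OF S(1), of "\<chi> i. 1"] S(3)
    unfolding T_def sandwich_ones[symmetric] by simp
  moreover have "matrix_inv B = sandwich T (\<chi> i. inverse (\<mu> $ i))"
    using matrix_inv_sandwich[OF S(1), of \<mu>] S(4) nz by (simp add: T_def)
  moreover have "matrix_inv (geo_mean t A B) = sandwich T (\<chi> i. inverse (\<mu> $ i powr t))"
    using S nz by (simp add: geo_mean_congruence_form matrix_inv_sandwich T_def)
  moreover have "inverse (\<mu> $ i powr t) = inverse (\<mu> $ i) powr t" for i
    using S(2)[rule_format, of i] by (simp add: inverse_powr less_imp_le)
  ultimately show ?thesis
    using geo_mean_congruence_form[OF T, of "\<chi> i. inverse (\<mu> $ i)" t] S(2) by simp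
qed

section \<open>Trace inequalities\<close>

lemma bernoulli_powr_nonpos:
  fixes z a :: real
  assumes "z > 0" "a \<le> 0"
  shows "1 + a * (z - 1) \<le> z powr a"
proof -
  have "1 + a * (z - 1) \<le> 1 + a * ln z"
    using ln_le_minus_one[OF assms(1)] assms(2) by (simp add: mult_left_mono_neg)
  also have "\<dots> \<le> exp (a * ln z)" by (rule exp_ge_add_one_self)
  also have "\<dots> = z powr a" using assms by (simp add: powr_def)
  finally show ?thesis .
qed

lemma powr_affine_le:
  fixes x y a :: real
  assumes "x > 0" "y > 0" "a \<le> 0"
  shows "a * x + (1 - a) * y \<le> x powr a * y powr (1 - a)"
proof -
  have "a * x + (1 - a) * y = y * (1 + a * (x / y - 1))"
    using assms by (simp add: field_simps)
  also have "\<dots> \<le> y * (x / y) powr a"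
    using assms by (intro mult_left_mono bernoulli_powr_nonpos) auto
  also have "\<dots> = x powr a * y powr (1 - a)"
    using assms by (simp add: powr_divide powr_diff)
  finally show ?thesis .
qed

text \<open>
  After both sums are normalised to \<open>1\<close>, the two inequalities arise by summing the comparison of
  \<open>x powr a * y powr (1 - a)\<close> with \<open>a x + (1 - a) y\<close>, whose direction changes at \<open>a = 0\<close>.
\<close>
lemma
  fixes w u v :: "'a \<Rightarrow> real"
  assumes w: "\<And>i. i \<in> I \<Longrightarrow> w i \<ge> 0" and u: "\<And>i. i \<in> I \<Longrightarrow> u i > 0" and v: "\<And>i. i \<in> I \<Longrightarrow> v i > 0"
    and U: "(\<Sum>i\<in>I. w i * u i) > 0" and V: "(\<Sum>i\<in>I. w i * v i) > 0"
  shows weighted_Hoelder: "0 \<le> a \<Longrightarrow> a \<le> 1 \<Longrightarrow>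
      (\<Sum>i\<in>I. w i * (u i powr a * v i powr (1 - a)))
        \<le> (\<Sum>i\<in>I. w i * u i) powr a * (\<Sum>i\<in>I. w i * v i) powr (1 - a)" (is "_ \<Longrightarrow> _ \<Longrightarrow> ?L \<le> ?R")
    and weighted_reverse_Hoelder: "a \<le> 0 \<Longrightarrow>
      (\<Sum>i\<in>I. w i * u i) powr a * (\<Sum>i\<in>I. w i * v i) powr (1 - a)
        \<le> (\<Sum>i\<in>I. w i * (u i powr a * v i powr (1 - a)))"
proof -
  let ?U = "\<Sum>i\<in>I. w i * u i" and ?V = "\<Sum>i\<in>I. w i * v i"
  have lin: "(\<Sum>i\<in>I. w i * (a * (u i / ?U) + (1 - a) * (v i / ?V))) = 1"
  proof -
    have "(\<Sum>i\<in>I. w i * (a * (u i / ?U) + (1 - a) * (v i / ?V)))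
        = (\<Sum>i\<in>I. a / ?U * (w i * u i) + (1 - a) / ?V * (w i * v i))"
      by (intro sum.cong) (auto simp: algebra_simps)
    also have "\<dots> = a / ?U * ?U + (1 - a) / ?V * ?V"
      by (simp only: sum.distrib sum_distrib_left)
    finally show ?thesis using U V by simp
  qed
  have norm: "(\<Sum>i\<in>I. w i * ((u i / ?U) powr a * (v i / ?V) powr (1 - a))) = ?L / ?R"
    unfolding sum_divide_distrib
    by (intro sum.cong refl) (use U V u v in \<open>auto simp: powr_divide less_imp_le\<close>)
  have R: "?R > 0" using U V by simp
  show "?L \<le> ?R" if "0 \<le> a" "a \<le> 1"
  proof -
    have "(\<Sum>i\<in>I. w i * ((u i / ?U) powr a * (v i / ?V) powr (1 - a))) \<le>
        (\<Sum>i\<in>I. w i * (a * (u i / ?U) + (1 - a) * (v i / ?V)))"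
    proof (intro sum_mono mult_left_mono w)
      fix i assume "i \<in> I"
      then have "u i / ?U > 0" "v i / ?V > 0" using u v U V by simp_all
      then show "(u i / ?U) powr a * (v i / ?V) powr (1 - a) \<le> a * (u i / ?U) + (1 - a) * (v i / ?V)"
        using that by (intro Youngs_inequality_0) auto
    qed
    then show ?thesis unfolding lin norm using pos_divide_le_eq[OF R] by simp
  qed
  show "?R \<le> ?L" if "a \<le> 0"
  proof -
    have "(\<Sum>i\<in>I. w i * (a * (u i / ?U) + (1 - a) * (v i / ?V))) \<le>
        (\<Sum>i\<in>I. w i * ((u i / ?U) powr a * (v i / ?V) powr (1 - a)))"
    proof (intro sum_mono mult_left_mono w)
      fix i assume "i \<in> I"
      then have "u i / ?U > 0" "v i / ?V > 0" using u v U V by simp_all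
      then show "a * (u i / ?U) + (1 - a) * (v i / ?V) \<le> (u i / ?U) powr a * (v i / ?V) powr (1 - a)"
        using that by (intro powr_affine_le)
    qed
    then show ?thesis unfolding lin norm using pos_le_divide_eq[OF R] by simp
  qed
qed

abbreviation rtrace :: "complex ^ 'n ^ 'n \<Rightarrow> real" where
  "rtrace A \<equiv> Re (trace A)"

lemma rtrace_sandwich: "unitary U \<Longrightarrow> rtrace (sandwich U d) = (\<Sum>i\<in>UNIV. d $ i)"
  by (simp add: trace_sandwich)

lemma rtrace_pos:
  assumes "pos_def A"
  shows "rtrace A > 0"
proof -
  obtain U d where "unitary U" "\<forall>i. d $ i > 0" "A = sandwich U d"
    using assms by (rule pos_def_spectral)
  then show ?thesis by (simp add: trace_sandwich sum_pos)
qed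

lemma mat_powr_powr: "pos_def A \<Longrightarrow> mat_powr (mat_powr A s) t = mat_powr A (s * t)"
  by (rule pos_def_spectral, assumption) (simp add: mat_powr_sandwich powr_powr)

lemma unitary_row_sum:
  assumes "unitary W"
  shows "(\<Sum>j\<in>UNIV. (cmod (W $ i $ j))\<^sup>2) = 1"
proof -
  have "of_real (\<Sum>j\<in>UNIV. (cmod (W $ i $ j))\<^sup>2) = (W ** ctranspose W) $ i $ i"
    by (simp add: matrix_matrix_mult_def ctranspose_def complex_norm_square del: of_real_power)
  also have "\<dots> = 1" by (simp add: unitaryD[OF assms] mat_def)
  finally show ?thesis using of_real_eq_1_iff by blast
qed

lemma unitary_column_sum:
  assumes "unitary W"
  shows "(\<Sum>i\<in>UNIV. (cmod (W $ i $ j))\<^sup>2) = 1"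
  using unitary_row_sum[OF unitary_ctranspose[OF assms], of j] by (simp add: ctranspose_def)

lemma rtrace_sandwich_sandwich:
  "rtrace (sandwich U a ** sandwich V b)
     = (\<Sum>(i, j)\<in>UNIV. (cmod ((ctranspose U ** V) $ i $ j))\<^sup>2 * (a $ i * b $ j))"
proof -
  define W where "W = ctranspose U ** V"
  have "trace (sandwich U a ** sandwich V b)
      = trace (U ** (diag_mat a ** W ** diag_mat b ** ctranspose V))"
    by (simp add: sandwich_def matrix_mul_assoc W_def)
  also have "\<dots> = trace ((diag_mat a ** W ** diag_mat b ** ctranspose V) ** U)"
    by (rule trace_mul_sym)
  also have "\<dots> = trace ((diag_mat a ** W) ** (diag_mat b ** ctranspose W))"
    by (simp add: ctranspose_mult matrix_mul_assoc W_def)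
  also have "\<dots> = (\<Sum>i\<in>UNIV. \<Sum>j\<in>UNIV. of_real ((cmod (W $ i $ j))\<^sup>2 * (a $ i * b $ j)))"
    unfolding trace_def matrix_matrix_mult_def[of "diag_mat a ** W"]
    by (simp add: diag_mat_mult_nth complex_norm_square ctranspose_def ac_simps del: of_real_power)
  finally have "trace (sandwich U a ** sandwich V b)
      = of_real (\<Sum>i\<in>UNIV. \<Sum>j\<in>UNIV. (cmod (W $ i $ j))\<^sup>2 * (a $ i * b $ j))"
    by (simp only: of_real_sum)
  then show ?thesis
    by (simp only: Re_complex_of_real) (simp add: sum.cartesian_product W_def)
qed

text \<open>
  In eigenbases of \<open>P\<close> and \<open>Q\<close> the trace of \<open>P\<^sup>a Q\<^sup>1\<^sup>-\<^sup>a\<close> is a sum over pairs of eigenvalues,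
  weighted by a doubly stochastic matrix; both inequalities are the scalar ones for these weights.
\<close>
lemma
  fixes P Q :: "complex ^ 'n ^ 'n"
  assumes P: "pos_def P" and Q: "pos_def Q"
  shows trace_Hoelder: "0 \<le> a \<Longrightarrow> a \<le> 1 \<Longrightarrow>
      rtrace (mat_powr P a ** mat_powr Q (1 - a)) \<le> rtrace P powr a * rtrace Q powr (1 - a)"
    and trace_reverse_Hoelder: "a \<le> 0 \<Longrightarrow>
      rtrace P powr a * rtrace Q powr (1 - a) \<le> rtrace (mat_powr P a ** mat_powr Q (1 - a))"
proof -
  obtain U x where U: "unitary U" "\<forall>i. x $ i > 0" "P = sandwich U x"
    using P by (rule pos_def_spectral)
  obtain V y where V: "unitary V" "\<forall>i. y $ i > 0" "Q = sandwich V y"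
    using Q by (rule pos_def_spectral)
  define w where "w = (\<lambda>(i, j). (cmod ((ctranspose U ** V) $ i $ j))\<^sup>2)"
  have W: "unitary (ctranspose U ** V)" by (intro unitary_mult unitary_ctranspose U V)
  have "(\<Sum>p\<in>UNIV. w p * x $ fst p) = (\<Sum>i\<in>UNIV. \<Sum>j\<in>UNIV. w (i, j) * x $ i)"
    by (simp add: sum.cartesian_product case_prod_unfold)
  also have "\<dots> = (\<Sum>i\<in>UNIV. x $ i)"
    using unitary_row_sum[OF W] by (simp add: w_def flip: sum_distrib_right)
  finally have sx: "(\<Sum>p\<in>UNIV. w p * x $ fst p) = rtrace P" by (simp add: U rtrace_sandwich)
  have "(\<Sum>p\<in>UNIV. w p * y $ snd p) = (\<Sum>i\<in>UNIV. \<Sum>j\<in>UNIV. w (i, j) * y $ j)"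
    by (simp add: sum.cartesian_product case_prod_unfold)
  also have "\<dots> = (\<Sum>j\<in>UNIV. \<Sum>i\<in>UNIV. w (i, j) * y $ j)" by (rule sum.swap)
  also have "\<dots> = (\<Sum>j\<in>UNIV. y $ j)"
    using unitary_column_sum[OF W] by (simp add: w_def flip: sum_distrib_right)
  finally have sy: "(\<Sum>p\<in>UNIV. w p * y $ snd p) = rtrace Q" by (simp add: V rtrace_sandwich)
  have tr: "rtrace (mat_powr P a ** mat_powr Q (1 - a))
      = (\<Sum>p\<in>UNIV. w p * (x $ fst p powr a * y $ snd p powr (1 - a)))"
    by (simp add: U V mat_powr_sandwich rtrace_sandwich_sandwich w_def case_prod_unfold)
  have w: "w p \<ge> 0" for p by (simp add: w_def case_prod_unfold)
  note H = w U(2)[rule_format] V(2)[rule_format]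
  show "0 \<le> a \<Longrightarrow> a \<le> 1 \<Longrightarrow>
      rtrace (mat_powr P a ** mat_powr Q (1 - a)) \<le> rtrace P powr a * rtrace Q powr (1 - a)"
    unfolding tr sx[symmetric] sy[symmetric]
    by (rule weighted_Hoelder) (use H rtrace_pos P Q in \<open>auto simp: sx sy\<close>)
  show "a \<le> 0 \<Longrightarrow>
      rtrace P powr a * rtrace Q powr (1 - a) \<le> rtrace (mat_powr P a ** mat_powr Q (1 - a))"
    unfolding tr sx[symmetric] sy[symmetric]
    by (rule weighted_reverse_Hoelder) (use H rtrace_pos P Q in \<open>auto simp: sx sy\<close>)
qed

lemma pos_def_diagonal_pos:
  assumes "pos_def M"
  shows "Re (M $ k $ k) > 0"
proof -
  have 1: "M *v axis k 1 = column k M"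
    by (simp add: vec_eq_iff matrix_vector_mult_def column_def axis_def if_distrib[of "\<lambda>x. _ * x"]
        cong: if_cong)
  have "axis k 1 \<bullet> (M *v axis k 1) > 0"
    using assms by (simp add: pos_def_iff axis_eq_0_iff)
  then show ?thesis unfolding 1
    by (simp add: inner_axis' column_def inner_complex_def)
qed

text \<open>
  In congruence coordinates the dependence of the trace on \<open>d\<close> is linear with weights that do not
  involve \<open>d\<close>; along a geodesic, where \<open>d = \<mu>\<^sup>t\<close>, it is therefore a weighted power sum.
\<close>
lemma rtrace_sandwich_mult:
  "rtrace (sandwich S d ** D) = (\<Sum>k\<in>UNIV. Re ((ctranspose S ** D ** S) $ k $ k) * d $ k)"
proof -
  have "trace (sandwich S d ** D) = trace (S ** (diag_mat d ** ctranspose S ** D))"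
    by (simp add: sandwich_def matrix_mul_assoc)
  also have "\<dots> = trace ((diag_mat d ** ctranspose S ** D) ** S)"
    by (rule trace_mul_sym)
  also have "\<dots> = trace (diag_mat d ** (ctranspose S ** D ** S))"
    by (simp add: matrix_mul_assoc)
  also have "\<dots> = (\<Sum>k\<in>UNIV. of_real (d $ k) * (ctranspose S ** D ** S) $ k $ k)"
    by (simp add: trace_def diag_mat_mult_nth)
  finally show ?thesis by (simp add: Re_sum mult.commute)
qed

section \<open>Powers as superpositions of logarithms\<close>

text \<open>
  Near \<open>0\<close> the integrand is at most \<open>u\<^sup>-\<^sup>q\<close>, which is integrable because \<open>q < 1\<close>; near infinity the
  logarithm grows more slowly than \<open>u powr (q/2)\<close>, which suffices because \<open>q > 0\<close>.
\<close>
lemma ln_add_one_powr_integrable: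
  fixes q :: real
  assumes "0 < q" "q < 1"
  shows "set_integrable lborel {0<..} (\<lambda>u. ln (1 + u) * u powr (- q - 1))"
proof -
  have leb: "set_integrable lborel S f"
    if "f integrable_on S" "\<And>x. x \<in> S \<Longrightarrow> 0 \<le> f x" "S \<in> sets borel" "f \<in> borel_measurable borel"
    for f :: "real \<Rightarrow> real" and S
  proof -
    have "f absolutely_integrable_on S"
      using that(1,2) by (rule nonnegative_absolutely_integrable_1)
    then show ?thesis
      using that(3,4) by (simp add: set_integrable_def integrable_completion)
  qed
  have 1: "set_integrable lborel {0..1} (\<lambda>u::real. u powr (- q))"
    using assms by (intro leb integrable_on_powr_from_0) auto
  have 2: "set_integrable lborel {1..} (\<lambda>u::real. u powr (- q / 2 - 1))"
    using has_integral_powr_to_inf[of "- q / 2 - 1" 1] assms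
    by (intro leb) (auto simp: has_integral_integrable)
  have A: "set_integrable lborel {0<..1} (\<lambda>u. ln (1 + u) * u powr (- q - 1))"
  proof (rule set_integrable_bound[OF set_integrable_subset[OF 1, of "{0<..1}"]])
    show "AE x in lborel. x \<in> {0<..1} \<longrightarrow> norm (ln (1 + x) * x powr (- q - 1)) \<le> norm (x powr (- q))"
    proof (intro AE_I2 impI)
      fix x :: real assume x: "x \<in> {0<..1}"
      have "ln (1 + x) * x powr (- q - 1) \<le> x * x powr (- q - 1)"
        using x by (intro mult_right_mono ln_add_one_self_le_self) auto
      also have "\<dots> = x powr 1 * x powr (- q - 1)" using x by simp
      also have "\<dots> = x powr (- q)" by (subst powr_add[symmetric]) simp
      finally show "norm (ln (1 + x) * x powr (- q - 1)) \<le> norm (x powr (- q))"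
        using x by simp
    qed
  qed (auto simp: set_borel_measurable_def)
  have B: "set_integrable lborel {1..} (\<lambda>u. ln (1 + u) * u powr (- q - 1))"
  proof (rule set_integrable_bound[OF set_integrable_mult_right[OF 2, of "2 powr (q/2) / (q/2)"]])
    show "AE x in lborel. x \<in> {1..} \<longrightarrow> norm (ln (1 + x) * x powr (- q - 1))
        \<le> norm (2 powr (q/2) / (q/2) * x powr (- q / 2 - 1))"
    proof (intro AE_I2 impI)
      fix x :: real assume x: "x \<in> {1..}"
      have "ln (1 + x) \<le> (1 + x) powr (q/2) / (q/2)"
        using x assms by (intro ln_powr_bound) auto
      also have "\<dots> \<le> (2 * x) powr (q/2) / (q/2)"
        using x assms by (intro divide_right_mono powr_mono2) auto
      finally have "ln (1 + x) * x powr (- q - 1) \<le> (2 * x) powr (q/2) / (q/2) * x powr (- q - 1)"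
        by (rule mult_right_mono) simp
      also have "\<dots> = 2 powr (q/2) / (q/2) * (x powr (q/2) * x powr (- q - 1))"
        using x by (simp add: powr_mult)
      also have "x powr (q/2) * x powr (- q - 1) = x powr (- q / 2 - 1)"
        by (subst powr_add[symmetric]) (simp add: field_simps)
      finally show "norm (ln (1 + x) * x powr (- q - 1))
          \<le> norm (2 powr (q/2) / (q/2) * x powr (- q / 2 - 1))"
        using x assms by simp
    qed
  qed (auto simp: set_borel_measurable_def)
  have "set_integrable lborel ({0<..1} \<union> {1..}) (\<lambda>u. ln (1 + u) * u powr (- q - 1))"
    using A B by (rule set_integrable_Un) auto
  moreover have "{0<..1} \<union> {1..} = {0::real<..}" by auto
  ultimately show ?thesis by simp
qed

text \<open>Substituting \<open>u = x s\<close> shows that the integral scales like \<open>x\<^sup>q\<close>, whatever the kernel.\<close>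
lemma powr_eq_integral:
  fixes h :: "real \<Rightarrow> real"
  assumes q: "0 < q" "q < 1" and h: "h \<in> borel_measurable borel"
    and bound: "\<And>u. u > 0 \<Longrightarrow> 0 < h u \<and> h u \<le> ln (1 + u)"
  obtains C where "C > 0"
    "\<And>x. x > 0 \<Longrightarrow> has_bochner_integral lborel
        (\<lambda>s. indicator {0<..} s *\<^sub>R (h (x * s) * s powr (- q - 1))) (C * x powr q)"
proof -
  define F where "F = (\<lambda>u. indicator {0<..} u *\<^sub>R (h u * u powr (- q - 1)))"
  have meas: "F \<in> borel_measurable borel" using h unfolding F_def by measurable
  have "set_integrable lborel {0<..} (\<lambda>u. h u * u powr (- q - 1))"
  proof (rule set_integrable_bound[OF ln_add_one_powr_integrable[OF q]])
    show "AE x in lborel. x \<in> {0<..} \<longrightarrow> norm (h x * x powr (- q - 1)) \<le> norm (ln (1 + x) * x powr (- q - 1))"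
    proof (intro AE_I2 impI)
      fix x :: real assume "x \<in> {0<..}"
      then show "norm (h x * x powr (- q - 1)) \<le> norm (ln (1 + x) * x powr (- q - 1))"
        using bound[of x] by (simp add: abs_mult mult_right_mono)
    qed
  qed (use meas in \<open>auto simp: set_borel_measurable_def F_def\<close>)
  then have int: "integrable lborel F" by (simp add: set_integrable_def F_def)
  define C where "C = integral\<^sup>L lborel F"
  have F0: "F u \<ge> 0" for u using bound[of u] by (auto simp: F_def indicator_def)
  have "C > 0"
  proof (rule ccontr)
    assume "\<not> C > 0"
    moreover have "C \<ge> 0" unfolding C_def by (rule Bochner_Integration.integral_nonneg) (rule F0)
    ultimately have "C = 0" by simp
    then have "AE u in lborel. F u = 0"
      using integral_nonneg_eq_0_iff_AE[OF int] F0 by (simp add: C_def)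
    then have "AE u in lborel. u \<notin> {0<..1::real}"
    proof (rule AE_mp, intro AE_I2 impI)
      fix u :: real assume "F u = 0"
      then show "u \<notin> {0<..1}" using bound[of u] by (auto simp: F_def)
    qed
    then have "{0<..1::real} \<in> null_sets lborel"
      by (subst AE_iff_null_sets) simp_all
    then have "emeasure lborel {0<..1::real} = 0" by (rule null_setsD1)
    then show False by simp
  qed
  moreover have "has_bochner_integral lborel
      (\<lambda>s. indicator {0<..} s *\<^sub>R (h (x * s) * s powr (- q - 1))) (C * x powr q)" if x: "x > 0" for x
  proof -
    have "has_bochner_integral lborel (\<lambda>s. F (0 + x * s)) (C /\<^sub>R \<bar>x\<bar>)"
      using lborel_has_bochner_integral_real_affine_iff[of x F C 0] x int
      by (simp add: C_def has_bochner_integral_integrable)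
    then have "has_bochner_integral lborel (\<lambda>s. x powr (q + 1) *\<^sub>R F (0 + x * s))
        (x powr (q + 1) *\<^sub>R (C /\<^sub>R \<bar>x\<bar>))"
      by (rule has_bochner_integral_scaleR_right)
    moreover have "x powr (q + 1) *\<^sub>R F (0 + x * s)
        = indicator {0<..} s *\<^sub>R (h (x * s) * s powr (- q - 1))" for s
    proof (cases "s > 0")
      case True
      have "x powr (q + 1) * x powr (- q - 1) = 1"
        using x by (simp flip: powr_add)
      then show ?thesis using True x
        by (simp add: F_def powr_mult zero_less_mult_iff)
    qed (use x in \<open>auto simp: F_def zero_less_mult_iff\<close>)
    moreover have "x powr (q + 1) *\<^sub>R (C /\<^sub>R \<bar>x\<bar>) = C * x powr q"
      using x by (simp add: powr_add)
    ultimately show ?thesis by (simp only:)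
  qed
  ultimately show thesis using that by blast
qed

text \<open>
  An inequality between combinations of \<open>h(x s)\<close> that holds at every scale \<open>s\<close> passes to the same
  combinations of \<open>x\<^sup>q\<close>.
\<close>
lemma powr_sum_le_of_kernel:
  fixes h :: "real \<Rightarrow> real" and \<alpha> x :: "'a \<Rightarrow> real" and \<beta> y :: "'b \<Rightarrow> real"
  assumes q: "0 < q" "q < 1" and h: "h \<in> borel_measurable borel"
    and bound: "\<And>u. u > 0 \<Longrightarrow> 0 < h u \<and> h u \<le> ln (1 + u)"
    and x: "\<And>i. i \<in> I \<Longrightarrow> x i > 0" and y: "\<And>j. j \<in> J \<Longrightarrow> y j > 0"
    and le: "\<And>s. s > 0 \<Longrightarrow> (\<Sum>i\<in>I. \<alpha> i * h (x i * s)) \<le> (\<Sum>j\<in>J. \<beta> j * h (y j * s))"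
  shows "(\<Sum>i\<in>I. \<alpha> i * x i powr q) \<le> (\<Sum>j\<in>J. \<beta> j * y j powr q)"
proof -
  obtain C where C: "C > 0"
    and int: "\<And>x. x > 0 \<Longrightarrow> has_bochner_integral lborel
        (\<lambda>s. indicator {0<..} s *\<^sub>R (h (x * s) * s powr (- q - 1))) (C * x powr q)"
    using powr_eq_integral[OF q h bound] by metis
  have "has_bochner_integral lborel
      (\<lambda>s. \<Sum>i\<in>I. \<alpha> i * (indicator {0<..} s *\<^sub>R (h (x i * s) * s powr (- q - 1))))
      (\<Sum>i\<in>I. \<alpha> i * (C * x i powr q))"
    by (intro has_bochner_integral_sum has_bochner_integral_mult_right int x)
  moreover have "has_bochner_integral lborel
      (\<lambda>s. \<Sum>j\<in>J. \<beta> j * (indicator {0<..} s *\<^sub>R (h (y j * s) * s powr (- q - 1))))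
      (\<Sum>j\<in>J. \<beta> j * (C * y j powr q))"
    by (intro has_bochner_integral_sum has_bochner_integral_mult_right int y)
  moreover have "(\<Sum>i\<in>I. \<alpha> i * (indicator {0<..} s *\<^sub>R (h (x i * s) * s powr (- q - 1))))
      \<le> (\<Sum>j\<in>J. \<beta> j * (indicator {0<..} s *\<^sub>R (h (y j * s) * s powr (- q - 1))))" for s
  proof (cases "s > 0")
    case True
    have "(\<Sum>i\<in>I. \<alpha> i * h (x i * s)) * s powr (- q - 1) \<le> (\<Sum>j\<in>J. \<beta> j * h (y j * s)) * s powr (- q - 1)"
      by (intro mult_right_mono le True) simp
    then show ?thesis unfolding sum_distrib_right mult.assoc using True by simp
  qed simp
  ultimately have "(\<Sum>i\<in>I. \<alpha> i * (C * x i powr q)) \<le> (\<Sum>j\<in>J. \<beta> j * (C * y j powr q))"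
    by (metis (no_types, lifting) has_bochner_integral_iff integral_mono)
  then have "C * (\<Sum>i\<in>I. \<alpha> i * x i powr q) \<le> C * (\<Sum>j\<in>J. \<beta> j * y j powr q)"
    by (simp add: sum_distrib_left mult_ac)
  then show ?thesis using C by simp
qed

section \<open>Determinants along the geodesic\<close>

abbreviation rdet :: "complex ^ 'n ^ 'n \<Rightarrow> real" where
  "rdet A \<equiv> Re (det A)"

lemma det_diag_mat: "det (diag_mat d) = of_real (\<Prod>i\<in>UNIV. d $ i)"
  by (subst det_diagonal) (auto simp: diag_mat_def)

lemma det_sandwich: "unitary U \<Longrightarrow> det (sandwich U d) = of_real (\<Prod>i\<in>UNIV. d $ i)"
proof -
  assume U: "unitary U"
  have "det (sandwich U d) = det (U ** ctranspose U) * det (diag_mat d)"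
    by (simp add: sandwich_def det_mul)
  then show ?thesis by (simp add: unitaryD[OF U] det_diag_mat)
qed

lemma pos_def_det:
  assumes "pos_def A"
  shows "det A = of_real (rdet A)" "rdet A > 0"
proof -
  obtain U d where U: "unitary U" "\<forall>i. d $ i > 0" "A = sandwich U d"
    using assms by (rule pos_def_spectral)
  then have "det A = of_real (\<Prod>i\<in>UNIV. d $ i)" by (simp add: det_sandwich)
  moreover have "(\<Prod>i\<in>UNIV. d $ i) > 0" using U by (simp add: prod_pos)
  ultimately show "det A = of_real (rdet A)" "rdet A > 0" by (metis Re_complex_of_real)+
qed

lemma inner_diag_mat: "x \<bullet> (diag_mat d *v x) = (\<Sum>k\<in>UNIV. d $ k * (cmod (x $ k))\<^sup>2)"
  using inner_sandwich[of x "mat 1" d] by (simp add: sandwich_def)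

lemma pos_def_add_diag_mat:
  assumes "pos_def Z" "\<And>i. d $ i \<ge> 0"
  shows "pos_def (Z + diag_mat d)"
  using assms unfolding pos_def_iff
  by (auto simp: hermitian_def ctranspose_add matrix_vector_mult_add_rdistrib inner_add_right
      inner_diag_mat sum_nonneg intro: add_pos_nonneg)

text \<open>
  The first product keeps only the permutations that fix \<open>S\<close> pointwise, so this is the principal minor
  of \<open>Z\<close> on the complement of \<open>S\<close>. Written as a sum over all permutations it needs no submatrices.
\<close>
definition minor_coeff :: "complex ^ 'n ^ 'n \<Rightarrow> 'n set \<Rightarrow> complex" where
  "minor_coeff Z S = (\<Sum>p | p permutes UNIV. of_int (sign p) *
      ((\<Prod>i\<in>S. if i = p i then 1 else 0) * (\<Prod>i\<in>UNIV - S. Z $ i $ p i)))"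

lemma det_add_diag_mat:
  "rdet (Z + diag_mat d) = (\<Sum>S\<in>UNIV. Re (minor_coeff Z S) * (\<Prod>i\<in>S. d $ i))"
proof -
  have row: "(\<Prod>i\<in>UNIV. (Z + diag_mat d) $ i $ p i) =
      (\<Sum>S\<in>UNIV. of_real (\<Prod>i\<in>S. d $ i) * ((\<Prod>i\<in>S. if i = p i then 1 else 0) *
          (\<Prod>i\<in>UNIV - S. Z $ i $ p i)))" for p
  proof -
    have "(\<Prod>i\<in>UNIV. (Z + diag_mat d) $ i $ p i) =
        (\<Prod>i\<in>UNIV. of_real (d $ i) * (if i = p i then 1 else 0) + Z $ i $ p i)"
      by (intro prod.cong) (auto simp: diag_mat_def)
    also have "\<dots> = (\<Sum>S\<in>UNIV. (\<Prod>i\<in>S. of_real (d $ i) * (if i = p i then 1 else 0)) *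
        (\<Prod>i\<in>UNIV - S. Z $ i $ p i))"
      by (subst prod_add) simp_all
    finally show ?thesis by (simp only: prod.distrib of_real_prod mult.assoc)
  qed
  have "det (Z + diag_mat d) = (\<Sum>S\<in>UNIV. of_real (\<Prod>i\<in>S. d $ i) * minor_coeff Z S)"
    unfolding det_def row minor_coeff_def sum_distrib_left
    by (subst sum.swap) (simp add: mult_ac)
  then show ?thesis by (simp add: mult.commute del: of_real_prod)
qed

text \<open>
  The coefficient of \<open>\<Prod>\<^sub>i\<^sub>\<in>\<^sub>S d\<^sub>i\<close> dominates \<open>det (Z + diag d)\<close> when the entries of \<open>d\<close> in \<open>S\<close> tend to
  infinity and the others vanish, and these determinants are positive.
\<close>
lemma minor_coeff_nonneg:
  assumes "pos_def Z"
  shows "Re (minor_coeff Z S) \<ge> 0"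
proof -
  \<comment> \<open>\<open>g e\<close> is \<open>e ^ card S\<close> times the determinant with entries \<open>1 / e\<close> on \<open>S\<close> and \<open>0\<close> elsewhere\<close>
  define g where "g = (\<lambda>e::real. \<Sum>T\<in>Pow S. Re (minor_coeff Z T) * e ^ (card S - card T))"
  have g_pos: "g e \<ge> 0" if e: "e > 0" for e
  proof -
    have "0 \<le> e ^ card S * rdet (Z + diag_mat (\<chi> i. if i \<in> S then 1 / e else 0))"
      using e by (intro mult_nonneg_nonneg less_imp_le[OF pos_def_det(2)] pos_def_add_diag_mat assms) auto
    also have "\<dots> = (\<Sum>T\<in>UNIV. Re (minor_coeff Z T) *
        (e ^ card S * (\<Prod>i\<in>T. if i \<in> S then 1 / e else 0)))"
      by (simp add: det_add_diag_mat sum_distrib_left mult_ac)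
    also have "\<dots> = (\<Sum>T\<in>Pow S. Re (minor_coeff Z T) *
        (e ^ card S * (\<Prod>i\<in>T. if i \<in> S then 1 / e else 0)))"
      by (rule sum.mono_neutral_right) auto
    also have "\<dots> = g e"
      unfolding g_def
    proof (intro sum.cong refl arg_cong[where f = "(*) _"])
      fix T assume T: "T \<in> Pow S"
      then have "(\<Prod>i\<in>T. if i \<in> S then 1 / e else 0) = (1 / e) ^ card T"
        by (simp add: subset_iff prod.If_cases Int_absorb2 subsetI flip: prod_constant cong: prod.cong)
      moreover have "card T \<le> card S" using T by (auto intro: card_mono)
      ultimately show "e ^ card S * (\<Prod>i\<in>T. if i \<in> S then 1 / e else 0) = e ^ (card S - card T)"
        using e by (simp add: power_diff power_one_over field_simps)
    qed
    finally show ?thesis .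
  qed
  have "continuous (at_right 0) g" unfolding g_def by (intro continuous_intros)
  then have "(g \<longlongrightarrow> g 0) (at_right 0)" by (simp add: continuous_within)
  moreover have "eventually (\<lambda>e. g e \<ge> 0) (at_right 0)"
    using g_pos by (auto simp: eventually_at_right_less intro: eventually_mono[OF eventually_at_right_less])
  ultimately have "g 0 \<ge> 0"
    by (rule tendsto_lowerbound) simp
  moreover have "g 0 = Re (minor_coeff Z S)"
  proof -
    have "g 0 = (\<Sum>T\<in>Pow S. if T = S then Re (minor_coeff Z S) else 0)"
      unfolding g_def
    proof (intro sum.cong refl)
      fix T assume T: "T \<in> Pow S"
      then have "T = S \<or> card T < card S" by (auto intro: psubset_card_mono)
      then show "Re (minor_coeff Z T) * 0 ^ (card S - card T) = (if T = S then Re (minor_coeff Z S) else 0)"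
        by auto
    qed
    then show ?thesis by simp
  qed
  ultimately show ?thesis by simp
qed

text \<open>
  As a function of \<open>t\<close> the determinant is a combination of exponentials with nonnegative coefficients,
  hence logarithmically convex.
\<close>
lemma rdet_add_diag_mat_log_convex:
  assumes Z: "pos_def Z" and \<mu>: "\<And>i. \<mu> $ i > 0" and s: "s > 0" and t: "0 \<le> t" "t \<le> 1"
  shows "rdet (Z + diag_mat (\<chi> i. s * \<mu> $ i powr t))
    \<le> rdet (Z + diag_mat (\<chi> i. s * 1)) powr (1 - t) * rdet (Z + diag_mat (\<chi> i. s * \<mu> $ i)) powr t"
proof -
  define w where "w = (\<lambda>S. Re (minor_coeff Z S) * s ^ card S)"
  define u where "u = (\<lambda>S. \<Prod>i\<in>S. \<mu> $ i)"
  have w: "w S \<ge> 0" for S using minor_coeff_nonneg[OF Z] s by (simp add: w_def)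
  have u: "u S > 0" for S using \<mu> by (simp add: u_def prod_pos)
  have 0: "rdet (Z + diag_mat (\<chi> i. s * 1)) = (\<Sum>S\<in>UNIV. w S * 1)"
    by (simp add: det_add_diag_mat w_def)
  have 1: "rdet (Z + diag_mat (\<chi> i. s * \<mu> $ i)) = (\<Sum>S\<in>UNIV. w S * u S)"
    by (simp add: det_add_diag_mat w_def u_def prod.distrib mult.assoc)
  have "rdet (Z + diag_mat (\<chi> i. s * \<mu> $ i powr t)) = (\<Sum>S\<in>UNIV. w S * (u S powr t * 1 powr (1 - t)))"
    using \<mu> by (simp add: det_add_diag_mat w_def u_def prod.distrib mult.assoc prod_powr_distrib less_imp_le)
  also have "\<dots> \<le> (\<Sum>S\<in>UNIV. w S * u S) powr t * (\<Sum>S\<in>UNIV. w S * 1) powr (1 - t)"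
  proof (rule weighted_Hoelder)
    have "pos_def (Z + diag_mat (\<chi> i. s * 1))" "pos_def (Z + diag_mat (\<chi> i. s * \<mu> $ i))"
      using \<mu> s by (auto intro!: pos_def_add_diag_mat Z simp: less_imp_le)
    then show "(\<Sum>S\<in>UNIV. w S * u S) > 0" "(\<Sum>S\<in>UNIV. w S * 1) > 0"
      unfolding 0[symmetric] 1[symmetric] by (auto dest: pos_def_det(2))
  qed (use w u t in auto)
  finally show ?thesis unfolding 0 1 by (simp only: mult.commute)
qed

text \<open>
  With \<open>A = S S\<^sup>*\<close> and \<open>A #\<^sub>t B = S diag(\<mu>\<^sup>t) S\<^sup>*\<close> the matrix \<open>1 + s (A #\<^sub>t B)\<close> is
  \<open>S (Z + s diag(\<mu>\<^sup>t)) S\<^sup>*\<close> for \<open>Z = (S\<^sup>* S)\<^sup>-\<^sup>1\<close>, and the factor \<open>det A\<close> that this costs is the same for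
  all \<open>t\<close>.
\<close>
lemma rdet_one_plus_geo_mean_le:
  assumes A: "pos_def A" and B: "pos_def B" and s: "s > 0" and t: "0 \<le> t" "t \<le> 1"
  shows "rdet (mat 1 + s *\<^sub>R geo_mean t A B)
    \<le> rdet (mat 1 + s *\<^sub>R A) powr (1 - t) * rdet (mat 1 + s *\<^sub>R B) powr t"
proof -
  obtain S \<mu> where S: "invertible S" "\<forall>i. \<mu> $ i > 0" "A = S ** ctranspose S" "B = sandwich S \<mu>"
    using A B by (rule pos_def_simultaneous_congruence)
  define T where "T = matrix_inv S"
  have ST: "S ** T = mat 1" using matrix_inv_mult[OF S(1)] by (simp add: T_def)
  then have ST': "ctranspose T ** ctranspose S = mat 1" by (simp flip: ctranspose_mult)
  define Z where "Z = T ** ctranspose T"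
  have "invertible T" using matrix_inv_mult[OF S(1)] unfolding invertible_def T_def by blast
  then have Z: "pos_def Z"
    using pos_def_sandwich[of T "\<chi> i. 1"] by (simp add: Z_def sandwich_ones)
  define K where "K = rdet A"
  have K: "K > 0" using pos_def_det(2)[OF A] by (simp add: K_def)
  have det: "rdet (mat 1 + s *\<^sub>R sandwich S d) = K * rdet (Z + diag_mat (\<chi> i. s * d $ i))" for d
  proof -
    have "S ** (Z + diag_mat (\<chi> i. s * d $ i)) ** ctranspose S
        = (S ** T) ** (ctranspose T ** ctranspose S) + s *\<^sub>R sandwich S d"
      by (simp add: Z_def matrix_add_ldistrib matrix_add_rdistrib matrix_mul_assoc
          sandwich_def[symmetric] sandwich_scale)
    then have "mat 1 + s *\<^sub>R sandwich S d = S ** (Z + diag_mat (\<chi> i. s * d $ i)) ** ctranspose S"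
      by (simp add: ST ST')
    then have "det (mat 1 + s *\<^sub>R sandwich S d)
        = det (S ** ctranspose S) * det (Z + diag_mat (\<chi> i. s * d $ i))"
      by (simp add: det_mul)
    also have "det (S ** ctranspose S) = of_real K"
      using pos_def_det(1)[OF A] S(3) by (simp add: K_def)
    finally show ?thesis by simp
  qed
  have pos: "rdet (Z + diag_mat (\<chi> i. s * d $ i)) > 0" if "\<forall>i. d $ i > 0" for d
    using that s by (intro pos_def_det(2) pos_def_add_diag_mat Z) (auto simp: less_imp_le)
  have "rdet (mat 1 + s *\<^sub>R geo_mean t A B) = K * rdet (Z + diag_mat (\<chi> i. s * \<mu> $ i powr t))"
    using det[of "\<chi> i. \<mu> $ i powr t"] S by (simp add: geo_mean_congruence_form)
  also have "\<dots> \<le> K * (rdet (Z + diag_mat (\<chi> i. s * 1)) powr (1 - t)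
      * rdet (Z + diag_mat (\<chi> i. s * \<mu> $ i)) powr t)"
    using S K s t Z by (intro mult_left_mono rdet_add_diag_mat_log_convex) auto
  also have "\<dots> = (K powr (1 - t) * K powr t) * (rdet (Z + diag_mat (\<chi> i. s * 1)) powr (1 - t)
      * rdet (Z + diag_mat (\<chi> i. s * \<mu> $ i)) powr t)"
    using K by (simp flip: powr_add)
  also have "\<dots> = (K * rdet (Z + diag_mat (\<chi> i. s * 1))) powr (1 - t)
      * (K * rdet (Z + diag_mat (\<chi> i. s * \<mu> $ i))) powr t"
    using K pos[of \<mu>] pos[of "\<chi> i. 1"] S(2) by (simp add: powr_mult less_imp_le)
  also have "K * rdet (Z + diag_mat (\<chi> i. s * 1)) = rdet (mat 1 + s *\<^sub>R A)"
    using det[of "\<chi> i. 1"] S(3) by (simp add: sandwich_ones)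
  also have "K * rdet (Z + diag_mat (\<chi> i. s * \<mu> $ i)) = rdet (mat 1 + s *\<^sub>R B)"
    using det[of \<mu>] S(4) by simp
  finally show ?thesis .
qed

lemma rdet_one_plus_sandwich:
  assumes "unitary U"
  shows "rdet (mat 1 + s *\<^sub>R sandwich U d) = (\<Prod>i\<in>UNIV. 1 + s * d $ i)"
proof -
  have "mat 1 + s *\<^sub>R sandwich U d = U ** (mat 1 + s *\<^sub>R diag_mat d) ** ctranspose U"
    by (simp add: sandwich_def matrix_add_ldistrib matrix_add_rdistrib unitaryD[OF assms]
        matrix_scalar_ac scalar_matrix_assoc)
  also have "mat 1 + s *\<^sub>R diag_mat d = diag_mat (\<chi> i. (\<chi> i. 1) $ i + (\<chi> i. s * d $ i) $ i)"
    unfolding diag_mat_add[symmetric] diag_mat_scaleR by simp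
  finally show ?thesis
    using det_sandwich[OF assms, of "\<chi> i. 1 + s * d $ i"]
    by (simp add: sandwich_def del: of_real_prod)
qed

text \<open>
  Taking logarithms of the determinants yields, at every scale \<open>s\<close>, an inequality between sums of
  \<open>ln (1 + \<lambda> s)\<close> over eigenvalues \<open>\<lambda>\<close>; integrating over \<open>s\<close> replaces these by \<open>\<lambda>\<^sup>q\<close>.
\<close>
lemma rtrace_powr_geo_mean_convex:
  assumes A: "pos_def A" and B: "pos_def B" and q: "0 < q" "q < 1" and t: "0 \<le> t" "t \<le> 1"
  shows "rtrace (mat_powr (geo_mean t A B) q)
    \<le> (1 - t) * rtrace (mat_powr A q) + t * rtrace (mat_powr B q)"
proof -
  obtain U a where U: "unitary U" "\<forall>i. a $ i > 0" "A = sandwich U a"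
    using A by (rule pos_def_spectral)
  obtain V b where V: "unitary V" "\<forall>i. b $ i > 0" "B = sandwich V b"
    using B by (rule pos_def_spectral)
  obtain W c where W: "unitary W" "\<forall>i. c $ i > 0" "geo_mean t A B = sandwich W c"
    using pos_def_geo_mean[OF A B] by (rule pos_def_spectral)
  let ?\<beta> = "case_sum (\<lambda>_. 1 - t) (\<lambda>_. t)" and ?y = "case_sum (\<lambda>i. a $ i) (\<lambda>i. b $ i)"
  have plus: "(\<Sum>j\<in>UNIV. f j) = (\<Sum>i\<in>UNIV. f (Inl i)) + (\<Sum>i\<in>UNIV. f (Inr i))"
    for f :: "'a + 'a \<Rightarrow> real"
    unfolding UNIV_Plus_UNIV[symmetric] by (subst sum.Plus) (auto simp: o_def)
  have ln_det: "ln (rdet (mat 1 + s *\<^sub>R sandwich X d)) = (\<Sum>i\<in>UNIV. ln (1 + d $ i * s))"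
    if "s > 0" "unitary X" "\<forall>i. d $ i > 0" for s X and d :: "real ^ 'a"
  proof -
    have "1 + s * d $ i > 0" for i using that by (simp add: add_pos_pos)
    then show ?thesis using that(2)
      by (simp add: rdet_one_plus_sandwich ln_prod less_imp_neq[THEN not_sym] mult.commute)
  qed
  have "(\<Sum>i\<in>UNIV. 1 * c $ i powr q) \<le> (\<Sum>j\<in>UNIV. ?\<beta> j * ?y j powr q)"
  proof (rule powr_sum_le_of_kernel[OF q, of "\<lambda>u. ln (1 + u)"])
    fix s :: real assume s: "s > 0"
    have pos: "rdet (mat 1 + s *\<^sub>R sandwich X d) > 0" if "unitary X" "\<forall>i. d $ i > 0" for X and d :: "real ^ 'a"
      using that s by (simp add: rdet_one_plus_sandwich prod_pos add_pos_pos)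
    have "ln (rdet (mat 1 + s *\<^sub>R sandwich W c)) \<le>
        ln (rdet (mat 1 + s *\<^sub>R A) powr (1 - t) * rdet (mat 1 + s *\<^sub>R B) powr t)"
      using rdet_one_plus_geo_mean_le[OF A B s t] pos[OF W(1,2)] unfolding W(3) by (simp add: ln_mono)
    also have "\<dots> = (1 - t) * ln (rdet (mat 1 + s *\<^sub>R A)) + t * ln (rdet (mat 1 + s *\<^sub>R B))"
      using pos[OF U(1,2)] pos[OF V(1,2)] by (simp add: U(3) V(3) ln_mult ln_powr)
    finally show "(\<Sum>i\<in>UNIV. 1 * ln (1 + c $ i * s)) \<le> (\<Sum>j\<in>UNIV. ?\<beta> j * ln (1 + ?y j * s))"
      using s U V W by (simp add: ln_det plus sum_distrib_left)
  qed (use U V W in \<open>auto simp: ln_add_one_self_le_self split: sum.split\<close>)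
  then show ?thesis
    using U V W by (simp add: mat_powr_sandwich rtrace_sandwich plus sum_distrib_left)
qed

text \<open>Rescaling \<open>A\<close> until both traces agree turns the arithmetic bound into the geometric one.\<close>
lemma rtrace_powr_geo_mean_le:
  assumes A: "pos_def A" and B: "pos_def B" and q: "0 < q" "q < 1" and t: "0 \<le> t" "t \<le> 1"
  shows "rtrace (mat_powr (geo_mean t A B) q)
    \<le> rtrace (mat_powr A q) powr (1 - t) * rtrace (mat_powr B q) powr t"
proof -
  define a where "a = rtrace (mat_powr A q)"
  define b where "b = rtrace (mat_powr B q)"
  have a: "a > 0" and b: "b > 0" using A B by (auto simp: a_def b_def rtrace_pos pos_def_mat_powr)
  \<comment> \<open>\<open>c\<close> makes \<open>Tr (c A)\<^sup>q\<close> equal to \<open>Tr B\<^sup>q\<close>\<close>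
  define c where "c = (b / a) powr (1 / q)"
  have c: "c > 0" "c powr q = b / a" using a b q by (auto simp: c_def powr_powr)
  have scale: "rtrace (mat_powr (k *\<^sub>R C) q) = k powr q * rtrace (mat_powr C q)"
    if k: "k > 0" and C: "pos_def C" for k and C :: "complex ^ 'a ^ 'a"
  proof -
    obtain U d where U: "unitary U" "\<forall>i. d $ i > 0" "C = sandwich U d"
      using C by (rule pos_def_spectral)
    then have "k *\<^sub>R C = sandwich U (\<chi> i. k * d $ i)" by (simp add: sandwich_scale)
    then show ?thesis
      using k U by (simp add: mat_powr_sandwich rtrace_sandwich powr_mult sum_distrib_left less_imp_le)
  qed
  have "rtrace (mat_powr (geo_mean t (c *\<^sub>R A) B) q) \<le> (1 - t) * rtrace (mat_powr (c *\<^sub>R A) q) + t * b"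
    unfolding b_def using c by (intro rtrace_powr_geo_mean_convex pos_def_scaleR A B q t)
  also have "\<dots> = (1 - t) * b + t * b" using a by (simp add: scale A c a_def[symmetric])
  finally have "rtrace (mat_powr (geo_mean t (c *\<^sub>R A) B) q) \<le> b" by (simp add: algebra_simps)
  moreover have "rtrace (mat_powr (geo_mean t (c *\<^sub>R A) B) q)
      = (c powr q) powr (1 - t) * rtrace (mat_powr (geo_mean t A B) q)"
  proof -
    have "(c powr (1 - t)) powr q = (c powr q) powr (1 - t)" by (simp only: powr_powr mult.commute)
    then show ?thesis using c(1) A B by (simp add: geo_mean_scale_left scale pos_def_geo_mean)
  qed
  ultimately have "(b / a) powr (1 - t) * rtrace (mat_powr (geo_mean t A B) q) \<le> b"
    by (simp add: c)
  then have "rtrace (mat_powr (geo_mean t A B) q) \<le> b / (b / a) powr (1 - t)"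
    using a b by (simp add: pos_le_divide_eq mult.commute)
  also have "\<dots> = a powr (1 - t) * b powr t"
    using a b by (simp add: powr_divide powr_diff)
  finally show ?thesis by (simp add: a_def b_def)
qed

section \<open>The Loewner order and the Loewner-Heinz inequality\<close>

definition loewner_le :: "complex ^ 'n ^ 'n \<Rightarrow> complex ^ 'n ^ 'n \<Rightarrow> bool" (infix "\<preceq>" 50) where
  "A \<preceq> B \<longleftrightarrow> (\<forall>x. x \<bullet> (A *v x) \<le> x \<bullet> (B *v x))"

lemma loewner_refl: "A \<preceq> A"
  by (simp add: loewner_le_def)

lemma loewner_trans: "A \<preceq> B \<Longrightarrow> B \<preceq> C \<Longrightarrow> A \<preceq> C"
  unfolding loewner_le_def by (meson order_trans)

lemma loewner_antisym:
  assumes "hermitian A" "hermitian B" "A \<preceq> B" "B \<preceq> A"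
  shows "A = B"
proof -
  have eq: "x \<bullet> ((A - B) *v x) = 0" for x
    using assms(3,4) by (simp add: loewner_le_def matrix_vector_mult_diff_rdistrib inner_diff_right antisym)
  have "hermitian (A - B)"
    using assms(1,2) by (simp add: hermitian_def ctranspose_def vec_eq_iff)
  then obtain U d where U: "unitary U" "A - B = sandwich U d" by (rule hermitian_spectral)
  have "d $ i = 0" for i
    using inner_sandwich_column[OF U(1), of i d] eq by (simp flip: U(2))
  then have "d = (\<chi> i. 0 * d $ i)" by (simp add: vec_eq_iff)
  then have "A - B = 0" unfolding U(2) by (metis sandwich_scale scaleR_zero_left)
  then show ?thesis by simp
qed

lemma loewner_scaleR: "A \<preceq> B \<Longrightarrow> c \<ge> 0 \<Longrightarrow> c *\<^sub>R A \<preceq> c *\<^sub>R B"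
  by (simp add: loewner_le_def mult_vec_scaleR mult_left_mono)

lemma loewner_scaleR_left: "pos_def A \<Longrightarrow> c \<le> d \<Longrightarrow> c *\<^sub>R A \<preceq> d *\<^sub>R A"
  unfolding loewner_le_def
proof
  fix x assume "pos_def A" "c \<le> d"
  then show "x \<bullet> ((c *\<^sub>R A) *v x) \<le> x \<bullet> ((d *\<^sub>R A) *v x)"
    by (cases "x = 0") (auto simp: mult_vec_scaleR pos_def_iff intro!: mult_right_mono less_imp_le)
qed

lemma loewner_sum: "(\<And>j. j \<in> J \<Longrightarrow> f j \<preceq> g j) \<Longrightarrow> sum f J \<preceq> sum g J"
  by (simp add: loewner_le_def mult_vec_sum inner_sum_right sum_mono)

lemma loewner_congruence: "A \<preceq> B \<Longrightarrow> S ** A ** ctranspose S \<preceq> S ** B ** ctranspose S"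
proof -
  assume "A \<preceq> B"
  have "x \<bullet> (S ** M ** ctranspose S *v x) = (ctranspose S *v x) \<bullet> (M *v (ctranspose S *v x))" for M x
    by (simp add: inner_ctranspose flip: matrix_vector_mul_assoc)
  then show ?thesis using \<open>A \<preceq> B\<close> by (simp add: loewner_le_def)
qed

lemma scaleR_mat_1_eq_sandwich: "unitary U \<Longrightarrow> c *\<^sub>R mat 1 = sandwich U (\<chi> i. c)"
  using sandwich_scale[of U c "\<chi> i. 1"] by (simp add: sandwich_ones unitaryD)

lemma pos_def_loewner_bounds:
  assumes "pos_def A"
  shows "\<exists>e>0. e *\<^sub>R mat 1 \<preceq> A" "\<exists>b>0. A \<preceq> b *\<^sub>R mat 1"
proof -
  obtain U d where U: "unitary U" "\<forall>i. d $ i > 0" "A = sandwich U d"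
    using assms by (rule pos_def_spectral)
  let ?D = "range (\<lambda>i. d $ i)"
  have 1: "x \<bullet> ((c *\<^sub>R mat 1) *v x) = (\<Sum>k\<in>UNIV. c * (cmod ((ctranspose U *v x) $ k))\<^sup>2)" for c x
    by (simp add: scaleR_mat_1_eq_sandwich[OF U(1)] inner_sandwich)
  have "Min ?D \<in> ?D" by (rule Min_in) auto
  then have "Min ?D > 0" using U by auto
  moreover have "Min ?D *\<^sub>R mat 1 \<preceq> A"
    unfolding loewner_le_def 1 U(3) inner_sandwich by (auto intro!: sum_mono mult_right_mono)
  ultimately show "\<exists>e>0. e *\<^sub>R mat 1 \<preceq> A" by blast
  have "Max ?D \<in> ?D" by (rule Max_in) auto
  then have "Max ?D > 0" using U(2) by (metis imageE)
  moreover have "A \<preceq> Max ?D *\<^sub>R mat 1"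
    unfolding loewner_le_def 1 U(3) inner_sandwich by (auto intro!: sum_mono mult_right_mono)
  ultimately show "\<exists>b>0. A \<preceq> b *\<^sub>R mat 1" by blast
qed

lemma unitary_norm_sum:
  assumes "unitary U"
  shows "(norm x)\<^sup>2 = (\<Sum>k\<in>UNIV. (cmod ((ctranspose U *v x) $ k))\<^sup>2)"
  using inner_sandwich[of x U "\<chi> i. 1"]
  by (simp add: sandwich_ones unitaryD[OF assms] power2_norm_eq_inner)

text \<open>The left-hand side is the minimum over \<open>z\<close> of the right-hand side, attained at \<open>z = x / (1 + k)\<close>.\<close>
lemma parallel_sum_le:
  fixes x z :: complex
  assumes "k > 0"
  shows "(cmod x)\<^sup>2 * (k / (1 + k)) \<le> k * (cmod z)\<^sup>2 + (cmod (x - z))\<^sup>2"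
proof -
  define p r where "p = cmod z" and "r = cmod (x - z)"
  have "cmod x \<le> p + r" using norm_triangle_ineq[of z "x - z"] by (simp add: p_def r_def)
  then have "(cmod x)\<^sup>2 * k \<le> (p + r)\<^sup>2 * k"
    using assms by (intro mult_right_mono power_mono) auto
  also have "\<dots> = (1 + k) * (k * p\<^sup>2 + r\<^sup>2) - (k * p - r)\<^sup>2"
    by (simp add: power2_eq_square algebra_simps)
  also have "\<dots> \<le> (1 + k) * (k * p\<^sup>2 + r\<^sup>2)" by simp
  finally show ?thesis
    using assms by (simp add: p_def r_def field_simps)
qed

text \<open>
  The quadratic form of \<open>sA (1 + sA)\<^sup>-\<^sup>1\<close> at \<open>x\<close> is the minimum over \<open>y\<close> of
  \<open>s (y \<bullet> A y) + |x - y|\<^sup>2\<close>, which is visibly monotone in \<open>A\<close>. Monotonicity of \<open>A\<^sup>p\<close> follows because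
  \<open>a\<^sup>p\<close> is a positive superposition of the kernels \<open>sa / (1 + sa)\<close>.
\<close>
theorem loewner_heinz:
  assumes A: "pos_def A" and B: "pos_def B" and le: "A \<preceq> B" and p: "0 \<le> p" "p \<le> 1"
  shows "mat_powr A p \<preceq> mat_powr B p"
proof -
  consider "p = 0" | "p = 1" | "0 < p" "p < 1" using p by linarith
  then show ?thesis
  proof cases
    case 3
    obtain U a where U: "unitary U" "\<forall>i. a $ i > 0" "A = sandwich U a"
      using A by (rule pos_def_spectral)
    obtain V b where V: "unitary V" "\<forall>i. b $ i > 0" "B = sandwich V b"
      using B by (rule pos_def_spectral)
    show ?thesis unfolding loewner_le_def
    proof
      fix x
      define \<alpha> where "\<alpha> = ctranspose U *v x"
      define \<beta> where "\<beta> = ctranspose V *v x"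
      have "(\<Sum>i\<in>UNIV. (cmod (\<alpha> $ i))\<^sup>2 * a $ i powr p) \<le> (\<Sum>j\<in>UNIV. (cmod (\<beta> $ j))\<^sup>2 * b $ j powr p)"
      proof (rule powr_sum_le_of_kernel[OF 3, of "\<lambda>u. u / (1 + u)"])
        fix s :: real assume s: "s > 0"
        have ks: "a $ i * s > 0" "b $ i * s > 0" for i using s U V by simp_all
        \<comment> \<open>\<open>y = (1 + sB)\<^sup>-\<^sup>1 x\<close>, the minimiser for \<open>B\<close>, serves as a competitor for \<open>A\<close>\<close>
        define y where "y = V *v (\<chi> j. \<beta> $ j /\<^sub>R (1 + b $ j * s))"
        have Vy: "ctranspose V *v y = (\<chi> j. \<beta> $ j /\<^sub>R (1 + b $ j * s))"
          by (simp add: y_def matrix_vector_mul_assoc unitaryD[OF V(1)])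
        have "(\<Sum>i\<in>UNIV. (cmod (\<alpha> $ i))\<^sup>2 * (a $ i * s / (1 + a $ i * s)))
            \<le> (\<Sum>i\<in>UNIV. a $ i * s * (cmod ((ctranspose U *v y) $ i))\<^sup>2
                + (cmod (\<alpha> $ i - (ctranspose U *v y) $ i))\<^sup>2)"
          by (intro sum_mono parallel_sum_le ks)
        also have "\<dots> = s * (y \<bullet> (A *v y)) + (norm (x - y))\<^sup>2"
          by (simp add: U(3) inner_sandwich unitary_norm_sum[OF U(1)] sum.distrib sum_distrib_left
              matrix_vector_mult_diff_distrib \<alpha>_def mult_ac)
        also have "\<dots> \<le> s * (y \<bullet> (B *v y)) + (norm (x - y))\<^sup>2"
          using le s by (simp add: loewner_le_def)
        also have "\<dots> = (\<Sum>j\<in>UNIV. b $ j * s * (cmod (\<beta> $ j /\<^sub>R (1 + b $ j * s)))\<^sup>2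
                + (cmod (\<beta> $ j - \<beta> $ j /\<^sub>R (1 + b $ j * s)))\<^sup>2)"
          by (simp add: V(3) inner_sandwich unitary_norm_sum[OF V(1)] sum.distrib sum_distrib_left
              matrix_vector_mult_diff_distrib Vy \<beta>_def[symmetric] mult_ac)
        also have "\<dots> = (\<Sum>j\<in>UNIV. (cmod (\<beta> $ j))\<^sup>2 * (b $ j * s / (1 + b $ j * s)))"
        proof (intro sum.cong refl)
          fix j
          define k where "k = b $ j * s"
          have k: "k > 0" using ks by (simp add: k_def)
          have "\<beta> $ j - \<beta> $ j /\<^sub>R (1 + k) = (1 - inverse (1 + k)) *\<^sub>R \<beta> $ j"
            by (simp add: scaleR_diff_left)
          also have "1 - inverse (1 + k) = k / (1 + k)" using k by (simp add: field_simps)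
          finally have "cmod (\<beta> $ j - \<beta> $ j /\<^sub>R (1 + k)) = k / (1 + k) * cmod (\<beta> $ j)"
            using k by simp
          moreover have "cmod (\<beta> $ j /\<^sub>R (1 + k)) = cmod (\<beta> $ j) / (1 + k)"
            using k by (simp add: divide_inverse mult.commute)
          moreover have "k * (c / (1 + k))\<^sup>2 + (k / (1 + k) * c)\<^sup>2 = c\<^sup>2 * (k / (1 + k))" for c
          proof -
            have "k * (c / (1 + k))\<^sup>2 + (k / (1 + k) * c)\<^sup>2 = c\<^sup>2 * k * (1 + k) / (1 + k)\<^sup>2"
              by (simp add: power_divide power_mult_distrib add_divide_distrib[symmetric])
                 (simp add: power2_eq_square algebra_simps)
            then show ?thesis using k by (simp add: power2_eq_square)
          qed
          ultimately show "b $ j * s * (cmod (\<beta> $ j /\<^sub>R (1 + b $ j * s)))\<^sup>2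
                + (cmod (\<beta> $ j - \<beta> $ j /\<^sub>R (1 + b $ j * s)))\<^sup>2
              = (cmod (\<beta> $ j))\<^sup>2 * (b $ j * s / (1 + b $ j * s))"
            by (simp add: k_def)
        qed
        finally show "(\<Sum>i\<in>UNIV. (cmod (\<alpha> $ i))\<^sup>2 * (a $ i * s / (1 + a $ i * s)))
            \<le> (\<Sum>j\<in>UNIV. (cmod (\<beta> $ j))\<^sup>2 * (b $ j * s / (1 + b $ j * s)))" .
      next
        fix u :: real assume u: "u > 0"
        have "ln (1 / (1 + u)) \<le> 1 / (1 + u) - 1" using u by (intro ln_le_minus_one) simp
        then show "0 < u / (1 + u) \<and> u / (1 + u) \<le> ln (1 + u)"
          using u by (simp add: ln_div field_simps)
      qed (use U V in auto)
      then show "x \<bullet> (mat_powr A p *v x) \<le> x \<bullet> (mat_powr B p *v x)"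
        by (simp add: U V mat_powr_sandwich inner_sandwich \<alpha>_def \<beta>_def mult.commute)
    qed
  qed (use A B le in \<open>simp_all add: mat_powr_0 mat_powr_1 loewner_refl\<close>)
qed

lemma geo_mean_mono_right:
  assumes "pos_def A" "pos_def B" "pos_def C" "B \<preceq> C" "0 \<le> t" "t \<le> 1"
  shows "geo_mean t A B \<preceq> geo_mean t A C"
proof -
  define R Q where "R = mat_powr A (1/2)" and "Q = mat_powr A (-1/2)"
  have R: "pos_def R" "ctranspose R = R" and Q: "pos_def Q" "ctranspose Q = Q"
    using pos_def_mat_powr[OF assms(1)] by (auto simp: R_def Q_def pos_def_def hermitian_def)
  have "pos_def (Q ** D ** ctranspose Q)" if "pos_def D" for D
    using that Q(1) by (intro pos_def_congruence pos_def_invertible)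
  then have "mat_powr (Q ** B ** ctranspose Q) t \<preceq> mat_powr (Q ** C ** ctranspose Q) t"
    using assms by (intro loewner_heinz loewner_congruence) auto
  from loewner_congruence[OF this, of R] show ?thesis
    unfolding geo_mean_def R_def[symmetric] Q_def[symmetric] R(2) Q(2) .
qed

text \<open>Exchanging the arguments turns this into monotonicity of the power \<open>1 - t\<close>.\<close>
lemma geo_mean_mono_left:
  assumes "pos_def A" "pos_def B" "pos_def C" "A \<preceq> B" "0 \<le> t" "t \<le> 1"
  shows "geo_mean t A C \<preceq> geo_mean t B C"
  using assms geo_mean_mono_right[of C A B "1 - t"] by (simp add: geo_mean_commute[of _ C t])

section \<open>Fixed points of monotone homogeneous maps\<close>

text \<open>
  The next two estimates relate the Loewner order to the norm topology: convergence in norm gives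
  closeness in the order, and order intervals are bounded in norm. The constants are crude.
\<close>
lemma inner_mult_vec_le_norm:
  fixes M :: "complex ^ 'n ^ 'n"
  shows "x \<bullet> (M *v x) \<le> real (CARD('n) * CARD('n)) * norm M * (norm x)\<^sup>2"
proof -
  have "x \<bullet> (M *v x) = (\<Sum>i\<in>UNIV. \<Sum>j\<in>UNIV. x $ i \<bullet> (M $ i $ j * x $ j))"
    by (simp add: inner_vec_def matrix_vector_mult_def inner_sum_right)
  also have "\<dots> \<le> (\<Sum>i\<in>(UNIV :: 'n set). \<Sum>j\<in>(UNIV :: 'n set). norm x * (norm M * norm x))"
  proof (intro sum_mono)
    fix i j
    have "x $ i \<bullet> (M $ i $ j * x $ j) \<le> norm (x $ i) * (norm (M $ i $ j) * norm (x $ j))"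
      using norm_cauchy_schwarz[of "x $ i" "M $ i $ j * x $ j"] by (simp add: norm_mult)
    also have "\<dots> \<le> norm x * (norm M * norm x)"
      by (intro mult_mono mult_nonneg_nonneg norm_ge_zero Finite_Cartesian_Product.norm_nth_le
          order_trans[OF Finite_Cartesian_Product.norm_nth_le[of "M $ i" j]
            Finite_Cartesian_Product.norm_nth_le[of M i]])
    finally show "x $ i \<bullet> (M $ i $ j * x $ j) \<le> norm x * (norm M * norm x)" .
  qed
  also have "\<dots> = real (CARD('n) * CARD('n)) * norm M * (norm x)\<^sup>2"
    by (simp add: power2_eq_square)
  finally show ?thesis .
qed

lemma loewner_bounded_norm:
  fixes A :: "complex ^ 'n ^ 'n"
  assumes A: "pos_def A" and le: "A \<preceq> b *\<^sub>R mat 1"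
  shows "norm A \<le> real CARD('n) ^ 3 * b"
proof -
  obtain U d where U: "unitary U" "\<forall>i. d $ i > 0" "A = sandwich U d"
    using A by (rule pos_def_spectral)
  have d: "d $ k \<le> b" for k
  proof -
    have "(U *v axis k 1) \<bullet> ((b *\<^sub>R mat 1) *v (U *v axis k 1)) = b"
      by (simp add: scaleR_mat_1_eq_sandwich[OF U(1)] inner_sandwich_column[OF U(1)])
    then show ?thesis
      using le inner_sandwich_column[OF U(1), of k d] unfolding loewner_le_def U(3) by metis
  qed
  have Ule: "cmod (U $ i $ k) \<le> 1" for i k
  proof -
    have "(cmod (U $ i $ k))\<^sup>2 \<le> (\<Sum>k\<in>UNIV. (cmod (U $ i $ k))\<^sup>2)"
      by (rule member_le_sum) auto
    then show ?thesis by (simp add: unitary_row_sum[OF U(1)] abs_square_le_1)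
  qed
  have entry: "cmod (A $ i $ j) \<le> CARD('n) * b" for i j
  proof -
    have "A $ i $ j = (\<Sum>k\<in>UNIV. U $ i $ k * of_real (d $ k) * cnj (U $ j $ k))"
      unfolding U(3) sandwich_def matrix_matrix_mult_def[of "U ** diag_mat d"]
      by (simp add: mult_diag_mat_nth) (simp add: ctranspose_def)
    also have "cmod \<dots> \<le> (\<Sum>k\<in>(UNIV :: 'n set). b)"
    proof (intro sum_norm_le)
      fix k
      have "norm (U $ i $ k * of_real (d $ k) * cnj (U $ j $ k)) = cmod (U $ i $ k) * d $ k * cmod (U $ j $ k)"
        using U(2) by (simp add: norm_mult less_imp_le)
      also have "\<dots> \<le> 1 * b * 1"
        using U(2) d Ule by (intro mult_mono) (auto simp: less_imp_le intro: order_trans[OF less_imp_le])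
      finally show "norm (U $ i $ k * of_real (d $ k) * cnj (U $ j $ k)) \<le> b" by simp
    qed
    finally show ?thesis by simp
  qed
  have "norm A \<le> (\<Sum>i\<in>UNIV. norm (A $ i))"
    unfolding norm_vec_def by (rule L2_set_le_sum) simp
  also have "\<dots> \<le> (\<Sum>i\<in>(UNIV :: 'n set). \<Sum>j\<in>(UNIV :: 'n set). CARD('n) * b)"
  proof (rule sum_mono)
    fix i
    have "norm (A $ i) \<le> (\<Sum>j\<in>UNIV. cmod (A $ i $ j))"
      unfolding norm_vec_def by (rule L2_set_le_sum) simp
    also have "\<dots> \<le> (\<Sum>j\<in>(UNIV :: 'n set). CARD('n) * b)" by (intro sum_mono entry)
    finally show "norm (A $ i) \<le> (\<Sum>j\<in>(UNIV :: 'n set). CARD('n) * b)" .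
  qed
  also have "\<dots> = real CARD('n) ^ 3 * b" by (simp add: power3_eq_cube)
  finally show ?thesis .
qed

lemma tendsto_inner_mult_vec:
  "(X \<longlongrightarrow> (L :: complex ^ 'n ^ 'n)) F \<Longrightarrow> ((\<lambda>k. x \<bullet> (X k *v x)) \<longlongrightarrow> x \<bullet> (L *v x)) F"
  unfolding matrix_vector_mult_def inner_vec_def
  by (simp only: vec_lambda_beta) (intro tendsto_sum tendsto_inner tendsto_mult tendsto_const tendsto_vec_nth)

text \<open>
  Homogeneity of degree \<open>k < 1\<close> makes a small multiple of the identity increase and a large one
  decrease under \<open>f\<close>. The iterates of the small one increase to a limit, which is a fixed point because
  homogeneity and monotonicity make \<open>f\<close> continuous from below along the order: \<open>c L \<preceq> X\<close> with \<open>c\<close> close to \<open>1\<close>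
  implies \<open>c\<^sup>k f(L) \<preceq> f(X)\<close>. Two fixed points with \<open>X \<preceq> c Y\<close> satisfy \<open>X \<preceq> c\<^sup>k Y\<close>, and iterating this
  drives the constant to \<open>1\<close>.
\<close>
theorem loewner_monotone_homogeneous_fixpoint:
  fixes f :: "complex ^ 'n ^ 'n \<Rightarrow> complex ^ 'n ^ 'n"
  assumes pd: "\<And>X. pos_def X \<Longrightarrow> pos_def (f X)"
    and mono: "\<And>X Y. pos_def X \<Longrightarrow> pos_def Y \<Longrightarrow> X \<preceq> Y \<Longrightarrow> f X \<preceq> f Y"
    and hom: "\<And>X c. pos_def X \<Longrightarrow> c > 0 \<Longrightarrow> f (c *\<^sub>R X) = c powr k *\<^sub>R f X"
    and k: "0 \<le> k" "k < 1"
  shows "\<exists>!X. pos_def X \<and> X = f X"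
proof (rule ex_ex1I)
  let ?I = "mat 1 :: complex ^ 'n ^ 'n"
  have pdI: "pos_def (c *\<^sub>R ?I)" if "c > 0" for c using that by (intro pos_def_scaleR pos_def_mat_1)
  obtain e where e: "e > 0" "e *\<^sub>R ?I \<preceq> f ?I"
    using pos_def_loewner_bounds(1)[OF pd[OF pos_def_mat_1]] by blast
  obtain B where B: "B > 0" "f ?I \<preceq> B *\<^sub>R ?I"
    using pos_def_loewner_bounds(2)[OF pd[OF pos_def_mat_1]] by blast
  \<comment> \<open>\<open>a\<close> solves \<open>a\<^sup>k e = a\<close>, so that \<open>a \<preceq> f(a)\<close>; likewise the second term in \<open>b\<close> solves \<open>b\<^sup>k B = b\<close>\<close>
  define a where "a = e powr (1 / (1 - k))"
  define b where "b = max a (B powr (1 / (1 - k)))"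
  have a: "a > 0" using e by (simp add: a_def)
  then have b: "b > 0" "a \<le> b" by (auto simp: b_def)
  have split: "c = c powr k * c powr (1 - k)" if "c > 0" for c
    using that by (simp flip: powr_add)
  have low: "a *\<^sub>R ?I \<preceq> f (a *\<^sub>R ?I)"
  proof -
    have "a powr (1 - k) = e" using e k by (simp add: a_def powr_powr)
    then have "a *\<^sub>R ?I = a powr k *\<^sub>R (e *\<^sub>R ?I)" using split[OF a] by simp
    also have "\<dots> \<preceq> a powr k *\<^sub>R f ?I" by (intro loewner_scaleR e) simp
    finally show ?thesis using a by (simp add: hom pos_def_mat_1)
  qed
  have high: "f (b *\<^sub>R ?I) \<preceq> b *\<^sub>R ?I"
  proof -
    have "B = (B powr (1 / (1 - k))) powr (1 - k)" using B k by (simp add: powr_powr)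
    also have "\<dots> \<le> b powr (1 - k)" using k by (intro powr_mono2) (auto simp: b_def)
    finally have Bb: "B \<le> b powr (1 - k)" .
    have "f (b *\<^sub>R ?I) = b powr k *\<^sub>R f ?I" using b by (simp add: hom pos_def_mat_1)
    also have "\<dots> \<preceq> b powr k *\<^sub>R (B *\<^sub>R ?I)" by (intro loewner_scaleR B) simp
    finally have "f (b *\<^sub>R ?I) \<preceq> (b powr k * B) *\<^sub>R ?I" by simp
    moreover have "(b powr k * B) *\<^sub>R ?I \<preceq> b *\<^sub>R ?I"
      using mult_left_mono[OF Bb powr_ge_zero[of b k]] split[OF b(1)]
      by (intro loewner_scaleR_left pos_def_mat_1) linarith
    ultimately show ?thesis by (rule loewner_trans)
  qed
  define X where "X = (\<lambda>i::nat. (f ^^ i) (a *\<^sub>R ?I))"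
  have XS: "X (Suc i) = f (X i)" for i by (simp add: X_def)
  have Xpd: "pos_def (X i)" for i
    by (induction i) (auto simp: X_def pdI a pd)
  have Xinc1: "X i \<preceq> X (Suc i)" for i
  proof (induction i)
    case 0 then show ?case using low by (simp add: X_def)
  next
    case (Suc i) then show ?case unfolding XS[of "Suc i"] by (subst XS) (intro mono Xpd)
  qed
  have Xinc: "X i \<preceq> X j" if "i \<le> j" for i j
    using that by (induction rule: dec_induct) (auto intro: loewner_refl loewner_trans Xinc1)
  have Xb: "X i \<preceq> b *\<^sub>R ?I" for i
  proof (induction i)
    case 0 then show ?case using b by (simp add: X_def loewner_scaleR_left pos_def_mat_1)
  next
    case (Suc i)
    then have "f (X i) \<preceq> f (b *\<^sub>R ?I)" by (intro mono Xpd pdI b)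
    then show ?case using high unfolding XS by (rule loewner_trans)
  qed
  have "bounded (range X)"
    unfolding bounded_iff using loewner_bounded_norm[OF Xpd Xb] by blast
  then obtain L r where r: "strict_mono r" and lim: "(X \<circ> r) \<longlonglongrightarrow> L"
    using bounded_imp_convergent_subsequence by blast
  have form_lim: "(\<lambda>i. x \<bullet> (X (r i) *v x)) \<longlonglongrightarrow> x \<bullet> (L *v x)" for x
    using tendsto_inner_mult_vec[OF lim] by simp
  have XL: "X i \<preceq> L" for i unfolding loewner_le_def
  proof
    fix x
    have "X i \<preceq> X (r j)" if "j \<ge> i" for j
      using that seq_suble[OF r, of j] by (intro Xinc) linarith
    then show "x \<bullet> (X i *v x) \<le> x \<bullet> (L *v x)"
      by (intro LIMSEQ_le_const[OF form_lim]) (auto simp: loewner_le_def)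
  qed
  have aL: "a *\<^sub>R ?I \<preceq> L" using XL[of 0] by (simp add: X_def)
  have Lpd: "pos_def L" unfolding pos_def_iff
  proof (intro conjI allI impI)
    have "L $ i $ j = cnj (L $ j $ i)" for i j
    proof (rule LIMSEQ_unique)
      show "(\<lambda>l. (X \<circ> r) l $ i $ j) \<longlonglongrightarrow> L $ i $ j" by (intro tendsto_vec_nth lim)
      have "(X \<circ> r) l $ i $ j = cnj ((X \<circ> r) l $ j $ i)" for l
        using pos_def_hermitian[OF Xpd[of "r l"]]
        by (auto simp: hermitian_def ctranspose_def vec_eq_iff)
      moreover have "(\<lambda>l. cnj ((X \<circ> r) l $ j $ i)) \<longlonglongrightarrow> cnj (L $ j $ i)"
        by (intro tendsto_cnj tendsto_vec_nth lim)
      ultimately show "(\<lambda>l. (X \<circ> r) l $ i $ j) \<longlonglongrightarrow> cnj (L $ j $ i)" by simp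
    qed
    then have "cnj (L $ j $ i) = L $ i $ j" for i j by metis
    then show "hermitian L" by (simp add: hermitian_def ctranspose_def vec_eq_iff)
    fix x :: "complex ^ 'n" assume "x \<noteq> 0"
    then have "0 < x \<bullet> ((a *\<^sub>R ?I) *v x)" using pdI[OF a] by (simp add: pos_def_iff)
    also have "\<dots> \<le> x \<bullet> (L *v x)" using aL by (simp add: loewner_le_def)
    finally show "0 < x \<bullet> (L *v x)" .
  qed
  \<comment> \<open>norm convergence is turned into order convergence with the lower bound \<open>a \<preceq> L\<close>\<close>
  have near: "\<exists>i. c *\<^sub>R L \<preceq> X i" if c: "0 < c" "c < 1" for c
  proof -
    let ?N = "real (CARD('n) * CARD('n))"
    have "(1 - c) * a / ?N > 0" using c a by simp
    from LIMSEQ_D[OF lim this] obtain i where "norm ((X \<circ> r) i - L) < (1 - c) * a / ?N" by blast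
    then have i: "norm (L - X (r i)) < (1 - c) * a / ?N" by (simp add: norm_minus_commute)
    have "c *\<^sub>R L \<preceq> X (r i)" unfolding loewner_le_def
    proof
      fix x
      have "x \<bullet> (L *v x) - x \<bullet> (X (r i) *v x) \<le> ?N * norm (L - X (r i)) * (norm x)\<^sup>2"
        using inner_mult_vec_le_norm[of x "L - X (r i)"]
        by (simp add: matrix_vector_mult_diff_rdistrib inner_diff_right)
      also have "\<dots> \<le> (1 - c) * a * (norm x)\<^sup>2"
        using i by (intro mult_right_mono) (simp_all add: field_simps)
      also have "\<dots> = (1 - c) * (x \<bullet> ((a *\<^sub>R ?I) *v x))"
        by (simp add: mult_vec_scaleR power2_norm_eq_inner)
      also have "\<dots> \<le> (1 - c) * (x \<bullet> (L *v x))"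
        using aL c by (intro mult_left_mono) (auto simp: loewner_le_def)
      finally show "x \<bullet> ((c *\<^sub>R L) *v x) \<le> x \<bullet> (X (r i) *v x)"
        by (simp add: mult_vec_scaleR algebra_simps)
    qed
    then show ?thesis by blast
  qed
  have Lf: "L \<preceq> f L" unfolding loewner_le_def
  proof
    fix x
    have "X i \<preceq> f L" for i
      using Xinc1[of i] mono[OF Xpd Lpd XL[of i]] unfolding XS by (rule loewner_trans)
    then show "x \<bullet> (L *v x) \<le> x \<bullet> (f L *v x)"
      by (intro LIMSEQ_le_const2[OF form_lim]) (auto simp: loewner_le_def)
  qed
  \<comment> \<open>\<open>c\<^sup>k f(L) \<preceq> L\<close> for all \<open>c < 1\<close>, and \<open>c \<le> c\<^sup>k\<close> because \<open>k \<le> 1\<close>\<close>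
  have fL: "f L \<preceq> L" unfolding loewner_le_def
  proof
    fix x
    have fL0: "0 \<le> x \<bullet> (f L *v x)"
      using pd[OF Lpd] by (cases "x = 0") (auto simp: pos_def_iff less_imp_le)
    show "x \<bullet> (f L *v x) \<le> x \<bullet> (L *v x)"
    proof (rule field_le_mult_one_interval)
      fix c :: real assume c: "0 < c" "c < 1"
      then obtain i where "c *\<^sub>R L \<preceq> X i" using near by blast
      then have "f (c *\<^sub>R L) \<preceq> f (X i)" using c by (intro mono Xpd pos_def_scaleR Lpd)
      then have "f (c *\<^sub>R L) \<preceq> L"
        using XL[of "Suc i"] unfolding XS by (rule loewner_trans)
      then have "c powr k *\<^sub>R f L \<preceq> L"
        using c by (simp add: hom[OF Lpd])
      moreover have "c \<le> c powr k" using c k powr_mono'[of k 1 c] by simp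
      then have "c * (x \<bullet> (f L *v x)) \<le> c powr k * (x \<bullet> (f L *v x))"
        using fL0 by (rule mult_right_mono)
      ultimately show "c * (x \<bullet> (f L *v x)) \<le> x \<bullet> (L *v x)"
        unfolding loewner_le_def mult_vec_scaleR inner_scaleR_right by (meson order_trans)
    qed
  qed
  have "L = f L" using Lpd pd[OF Lpd] Lf fL by (intro loewner_antisym pos_def_hermitian)
  then show "\<exists>X. pos_def X \<and> X = f X" using Lpd by blast
next
  fix X Y assume X: "pos_def X \<and> X = f X" and Y: "pos_def Y \<and> Y = f Y"
  have le: "X \<preceq> Y" if X: "pos_def X" "X = f X" and Y: "pos_def Y" "Y = f Y" for X Y
  proof -
    obtain e where e: "e > 0" "e *\<^sub>R mat 1 \<preceq> Y" using pos_def_loewner_bounds(1)[OF Y(1)] by blast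
    obtain b where b: "b > 0" "X \<preceq> b *\<^sub>R mat 1" using pos_def_loewner_bounds(2)[OF X(1)] by blast
    define c where "c = b / e"
    have c: "c > 0" using e b by (simp add: c_def)
    have "b *\<^sub>R mat 1 = c *\<^sub>R (e *\<^sub>R (mat 1 :: complex ^ 'n ^ 'n))" using e by (simp add: c_def)
    also have "\<dots> \<preceq> c *\<^sub>R Y" using e c by (intro loewner_scaleR) auto
    finally have start: "X \<preceq> c *\<^sub>R Y" using b loewner_trans by blast
    \<comment> \<open>applying \<open>f\<close> improves the constant from \<open>c\<close> to \<open>c\<^sup>k\<close>\<close>
    have iter: "X \<preceq> c powr (k ^ i) *\<^sub>R Y" for i
    proof (induction i)
      case (Suc i)
      then have "f X \<preceq> f (c powr (k ^ i) *\<^sub>R Y)" using c by (intro mono X Y pos_def_scaleR) auto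
      also have "\<dots> = c powr (k ^ Suc i) *\<^sub>R Y"
        using c by (simp add: hom[OF Y(1)] powr_powr mult.commute flip: Y(2))
      finally show ?case by (simp flip: X(2))
    qed (use start c in simp)
    show ?thesis unfolding loewner_le_def
    proof
      fix x
      have "(\<lambda>i. c powr (k ^ i) * (x \<bullet> (Y *v x))) \<longlonglongrightarrow> c powr 0 * (x \<bullet> (Y *v x))"
        using c k by (intro tendsto_intros LIMSEQ_power_zero) auto
      moreover have "x \<bullet> (X *v x) \<le> c powr (k ^ i) * (x \<bullet> (Y *v x))" for i
        using iter[of i] by (simp add: loewner_le_def mult_vec_scaleR)
      ultimately show "x \<bullet> (X *v x) \<le> x \<bullet> (Y *v x)"
        using LIMSEQ_le_const c by fastforce
    qed
  qed
  show "X = Y"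
    using le[OF conjunct1[OF X] conjunct2[OF X] conjunct1[OF Y] conjunct2[OF Y]]
      le[OF conjunct1[OF Y] conjunct2[OF Y] conjunct1[OF X] conjunct2[OF X]]
    by (rule loewner_antisym[OF pos_def_hermitian[OF conjunct1[OF X]] pos_def_hermitian[OF conjunct1[OF Y]]])
qed

lemma power_mean_pos_fixpoint:
  assumes "m \<ge> 1" and w: "\<And>j. j \<in> {1..m} \<Longrightarrow> w j > 0" and A: "\<And>j. j \<in> {1..m} \<Longrightarrow> pos_def (A j)"
    and t: "0 < t" "t \<le> 1"
  shows "pos_def (power_mean_pos m t w A)"
    and "power_mean_pos m t w A = (\<Sum>j=1..m. w j *\<^sub>R geo_mean t (power_mean_pos m t w A) (A j))"
proof -
  have "\<exists>!X. pos_def X \<and> X = (\<Sum>j=1..m. w j *\<^sub>R geo_mean t X (A j))"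
  proof (rule loewner_monotone_homogeneous_fixpoint[where k = "1 - t"])
    fix X Y :: "complex ^ 'a ^ 'a" and c :: real
    assume X: "pos_def X"
    show "pos_def (\<Sum>j=1..m. w j *\<^sub>R geo_mean t X (A j))"
      using \<open>m \<ge> 1\<close> by (intro pos_def_sum pos_def_scaleR pos_def_geo_mean X A w) auto
    show "(\<Sum>j=1..m. w j *\<^sub>R geo_mean t X (A j)) \<preceq> (\<Sum>j=1..m. w j *\<^sub>R geo_mean t Y (A j))"
      if "pos_def Y" "X \<preceq> Y"
      using X A w t that
      by (intro loewner_sum loewner_scaleR geo_mean_mono_left) (auto simp: less_imp_le)
    show "(\<Sum>j=1..m. w j *\<^sub>R geo_mean t (c *\<^sub>R X) (A j)) = c powr (1 - t) *\<^sub>R (\<Sum>j=1..m. w j *\<^sub>R geo_mean t X (A j))"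
      if "c > 0"
      unfolding scaleR_sum_right
      by (intro sum.cong refl) (simp add: geo_mean_scale_left X A that mult.commute)
  qed (use t in auto)
  note * = theI'[OF this, folded power_mean_pos_def]
  show "pos_def (power_mean_pos m t w A)" using * by (rule conjunct1)
  show "power_mean_pos m t w A = (\<Sum>j=1..m. w j *\<^sub>R geo_mean t (power_mean_pos m t w A) (A j))"
    using * by (rule conjunct2)
qed

section \<open>The norm inequality\<close>

text \<open>
  The functional \<open>M \<mapsto> Tr (M X\<^sup>-\<^sup>q\<^sup>-\<^sup>1)\<close> turns the fixed point equation of the power mean into a scalar
  inequality: this is the bound on each of its terms. For \<open>q \<ge> 1\<close> it compares the exponent \<open>t\<close>
  with the exponent \<open>-1\<close> in the pencil of \<open>X\<close> and \<open>A\<^sup>-\<^sup>1\<close>, where the trace is linear in \<open>A\<close>.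
  For \<open>q < 1\<close> Hoelder's inequality with exponent \<open>1/q\<close> is not available there. Instead the reverse
  inequality bounds the trace from below in terms of \<open>Tr (X\<^sup>-\<^sup>1 #\<^sub>t A)\<^sup>q\<close>, which the determinantal estimate controls.
\<close>
lemma rtrace_geo_mean_lower_bound:
  fixes X A :: "complex ^ 'n ^ 'n"
  assumes X: "pos_def X" and A: "pos_def A" and t: "0 < t" "t \<le> 1" and q: "q > 0"
  shows "rtrace (mat_powr A q) powr (- t / q) * rtrace (mat_powr X (- q)) powr (1 + t / q)
    \<le> rtrace (geo_mean t X (matrix_inv A) ** mat_powr X (- q - 1))"
proof -
  define a where "a = rtrace (mat_powr A q)"
  define g where "g = rtrace (mat_powr X (- q))"
  define D where "D = mat_powr X (- q - 1)"
  have a: "a > 0" and g: "g > 0"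
    using X A by (auto simp: a_def g_def rtrace_pos pos_def_mat_powr)
  have D: "pos_def D" using X by (simp add: D_def pos_def_mat_powr)
  have A': "pos_def (matrix_inv A)" using A by (rule pos_def_matrix_inv)
  have X': "pos_def (matrix_inv X)" using X by (rule pos_def_matrix_inv)
  have "a powr (- t / q) * g powr (1 + t / q) \<le> rtrace (geo_mean t X (matrix_inv A) ** D)"
  proof (cases "q \<ge> 1")
    case True
    obtain S \<mu> where S: "invertible S" "\<forall>i. \<mu> $ i > 0" "X = S ** ctranspose S"
      "matrix_inv A = sandwich S \<mu>"
      using X A' by (rule pos_def_simultaneous_congruence)
    define T where "T = matrix_inv S"
    have TS: "S ** T = mat 1" "T ** S = mat 1" using matrix_inv_mult[OF S(1)] by (simp_all add: T_def)
    have nz: "\<mu> $ i \<noteq> 0" for i using S(2)[rule_format, of i] by simp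
    \<comment> \<open>\<open>Tr (S diag(d) S\<^sup>* D) = \<Sum>\<^sub>k p\<^sub>k d\<^sub>k\<close>; the three cases \<open>d = 1\<close>, \<open>d = \<mu>\<^sup>-\<^sup>1\<close> and \<open>d = \<mu>\<^sup>t\<close> are compared\<close>
    define p where "p = (\<lambda>k. Re ((ctranspose S ** D ** S) $ k $ k))"
    have p: "p k > 0" for k
      using pos_def_congruence[OF D invertible_ctranspose[OF S(1)]]
      by (simp add: p_def pos_def_diagonal_pos)
    have sum_p: "(\<Sum>k\<in>UNIV. p k * 1) = g"
    proof -
      have "(\<Sum>k\<in>UNIV. p k * 1) = rtrace (X ** D)"
        using rtrace_sandwich_mult[of S "\<chi> i. 1" D] by (simp add: sandwich_ones p_def S(3))
      also have "X ** D = mat_powr X (- q)"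
        using mat_powr_mult[OF X, of 1 "- q - 1"] by (simp add: mat_powr_1 X D_def)
      finally show ?thesis by (simp add: g_def)
    qed
    have A_eq: "A = sandwich (ctranspose T) (\<chi> i. inverse (\<mu> $ i))"
      using matrix_inv_sandwich[OF S(1), of \<mu>] nz matrix_inv_matrix_inv[OF pos_def_invertible[OF A]]
      by (simp add: S(4) T_def)
    have "X ** ctranspose T = S"
      by (simp add: S(3) TS flip: matrix_mul_assoc ctranspose_mult)
    then have XAX: "X ** A ** X = sandwich S (\<chi> i. inverse (\<mu> $ i))"
      using sandwich_congruence[of X "ctranspose T"] pos_def_hermitian[OF X]
      by (simp add: A_eq hermitian_def)
    have sum_p_inv: "(\<Sum>k\<in>UNIV. p k * inverse (\<mu> $ k)) \<le> a powr (1 / q) * g powr (1 - 1 / q)"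
    proof -
      have "(\<Sum>k\<in>UNIV. p k * inverse (\<mu> $ k)) = rtrace (X ** (A ** X ** D))"
        using rtrace_sandwich_mult[of S "\<chi> i. inverse (\<mu> $ i)" D]
        by (simp add: p_def matrix_mul_assoc flip: XAX)
      also have "\<dots> = rtrace ((A ** X ** D) ** X)" by (simp only: trace_mul_sym[of X])
      also have "(A ** X ** D) ** X = A ** mat_powr X (1 - q)"
      proof -
        have "X ** D ** X = mat_powr X 1 ** D ** mat_powr X 1" by (simp add: mat_powr_1 X)
        also have "\<dots> = mat_powr X (1 - q)" by (simp add: D_def mat_powr_mult X)
        finally show ?thesis by (simp flip: matrix_mul_assoc)
      qed
      also have "A ** mat_powr X (1 - q)
          = mat_powr (mat_powr A q) (1 / q) ** mat_powr (mat_powr X (- q)) (1 - 1 / q)"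
        using q by (simp add: mat_powr_powr A X mat_powr_1 algebra_simps)
      also have "rtrace \<dots> \<le> a powr (1 / q) * g powr (1 - 1 / q)"
        unfolding a_def g_def using True
        by (intro trace_Hoelder pos_def_mat_powr A X) auto
      finally show ?thesis .
    qed
    have pos: "(\<Sum>k\<in>UNIV. p k * inverse (\<mu> $ k)) > 0"
      using p S(2) by (intro sum_pos mult_pos_pos) auto
    have "a powr (- t / q) * g powr (1 + t / q)
        = (a powr (1 / q) * g powr (1 - 1 / q)) powr (- t) * g powr (1 + t)"
    proof -
      have "g powr (1 + t / q) = g powr ((1 - 1 / q) * (- t)) * g powr (1 + t)"
        by (simp add: algebra_simps flip: powr_add)
      then show ?thesis by (simp add: powr_mult powr_powr)
    qed
    also have "\<dots> \<le> (\<Sum>k\<in>UNIV. p k * inverse (\<mu> $ k)) powr (- t) * (\<Sum>k\<in>UNIV. p k * 1) powr (1 - (- t))"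
    proof -
      have "(a powr (1 / q) * g powr (1 - 1 / q)) powr (- t)
          \<le> (\<Sum>k\<in>UNIV. p k * inverse (\<mu> $ k)) powr (- t)"
        using sum_p_inv pos t by (intro powr_mono2') auto
      then show ?thesis unfolding sum_p by (simp add: mult_right_mono)
    qed
    also have "\<dots> \<le> (\<Sum>k\<in>UNIV. p k * (inverse (\<mu> $ k) powr (- t) * 1 powr (1 - (- t))))"
      by (rule weighted_reverse_Hoelder) (use p S(2) pos sum_p g t in \<open>auto simp: less_imp_le\<close>)
    also have "\<dots> = (\<Sum>k\<in>UNIV. p k * \<mu> $ k powr t)"
      using S(2) by (simp add: inverse_powr powr_minus less_imp_le)
    also have "\<dots> = rtrace (geo_mean t X (matrix_inv A) ** D)"
      using S rtrace_sandwich_mult[of S "\<chi> i. \<mu> $ i powr t" D]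
      by (simp add: geo_mean_congruence_form p_def)
    finally show ?thesis .
  next
    case False
    define C where "C = geo_mean t X (matrix_inv A)"
    have C: "pos_def C" unfolding C_def using X A' by (rule pos_def_geo_mean)
    define c where "c = rtrace (mat_powr C (- q))"
    have c0: "c > 0" using C by (simp add: c_def rtrace_pos pos_def_mat_powr)
    have "matrix_inv C = geo_mean t (matrix_inv X) A"
      unfolding C_def by (simp add: matrix_inv_geo_mean X A' matrix_inv_matrix_inv pos_def_invertible A)
    then have "c = rtrace (mat_powr (geo_mean t (matrix_inv X) A) q)"
      using mat_powr_matrix_inv[OF C, of q] by (simp add: c_def)
    also have "\<dots> \<le> rtrace (mat_powr (matrix_inv X) q) powr (1 - t) * a powr t"
      unfolding a_def using False q t by (intro rtrace_powr_geo_mean_le X' A) auto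
    finally have c: "c \<le> g powr (1 - t) * a powr t"
      by (simp add: g_def mat_powr_matrix_inv X)
    have "a powr (- t / q) * g powr (1 + t / q)
        = (g powr (1 - t) * a powr t) powr (- 1 / q) * g powr (1 - (- 1 / q))"
    proof -
      have "g powr (1 + t / q) = g powr ((1 - t) * (- 1 / q)) * g powr (1 - (- 1 / q))"
        by (simp add: diff_divide_distrib add.commute flip: powr_add)
      then show ?thesis by (simp add: powr_mult powr_powr)
    qed
    also have "\<dots> \<le> c powr (- 1 / q) * g powr (1 - (- 1 / q))"
      using c c0 q by (intro mult_right_mono powr_mono2') auto
    also have "\<dots> \<le> rtrace (mat_powr (mat_powr C (- q)) (- 1 / q) ** mat_powr (mat_powr X (- q)) (1 - (- 1 / q)))"
      unfolding c_def g_def using q by (intro trace_reverse_Hoelder pos_def_mat_powr C X) auto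
    also have "mat_powr (mat_powr C (- q)) (- 1 / q) = C"
      using q by (simp add: mat_powr_powr C mat_powr_1)
    also have "mat_powr (mat_powr X (- q)) (1 - (- 1 / q)) = D"
    proof -
      have "- q * (1 - (- 1 / q)) = - q - 1" using q by (simp add: field_simps)
      then show ?thesis by (simp only: mat_powr_powr[OF X] D_def)
    qed
    finally show ?thesis by (simp add: C_def)
  qed
  then show ?thesis by (simp add: a_def g_def D_def)
qed

lemma rtrace_sum: "rtrace (sum f J) = (\<Sum>j\<in>J. rtrace (f j))"
  unfolding trace_def by (simp add: sum.swap[of _ _ J])

theorem corollary1p4:
  fixes m :: nat and w :: "nat \<Rightarrow> real" and A :: "nat \<Rightarrow> complex ^ 'n ^ 'n"
    and r q :: real
  assumes "m \<ge> 1"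
    and "\<And>j. j \<in> {1..m} \<Longrightarrow> w j > 0"
    and "(\<Sum>j=1..m. w j) = 1"
    and "\<And>j. j \<in> {1..m} \<Longrightarrow> pos_def (A j)"
    and "-1 \<le> r" and "r < 0"
    and "q > 0"
  shows "schatten q (power_mean m r w A)
           \<le> scalar_power_mean m r w (\<lambda>j. schatten q (A j))"
proof -
  define t where "t = - r"
  have t: "0 < t" "t \<le> 1" using assms by (auto simp: t_def)
  define X where "X = power_mean_pos m t w (\<lambda>j. matrix_inv (A j))"
  have B: "pos_def (matrix_inv (A j))" if "j \<in> {1..m}" for j
    using that by (intro pos_def_matrix_inv assms(4))
  have X: "pos_def X"
    unfolding X_def by (rule power_mean_pos_fixpoint(1)[OF assms(1) _ _ t]) (auto intro: B assms(2))
  have fixpoint: "X = (\<Sum>j=1..m. w j *\<^sub>R geo_mean t X (matrix_inv (A j)))"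
    unfolding X_def by (rule power_mean_pos_fixpoint(2)[OF assms(1) _ _ t]) (auto intro: B assms(2))
  define g where "g = rtrace (mat_powr X (- q))"
  define a where "a = (\<lambda>j. rtrace (mat_powr (A j) q))"
  have g: "g > 0" using X by (simp add: g_def rtrace_pos pos_def_mat_powr)
  have a: "a j > 0" if "j \<in> {1..m}" for j
    using that by (simp add: a_def rtrace_pos pos_def_mat_powr assms(4))
  have lhs: "schatten q (power_mean m r w A) = g powr (1 / q)"
    using assms(6) X by (simp add: power_mean_def flip: t_def X_def)
      (simp add: schatten_pos_def pos_def_matrix_inv mat_powr_matrix_inv g_def)
  define s where "s = (\<Sum>j=1..m. w j * a j powr (- t / q))"
  have rhs: "scalar_power_mean m r w (\<lambda>j. schatten q (A j)) = s powr (- 1 / t)"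
  proof -
    have "(schatten q (A j)) powr r = a j powr (- t / q)" if "j \<in> {1..m}" for j
      using that by (simp add: schatten_pos_def assms(4) a_def powr_powr t_def)
    then show ?thesis by (simp add: scalar_power_mean_def s_def t_def)
  qed
  have s: "s > 0" unfolding s_def
    using assms(1) by (intro sum_pos mult_pos_pos assms(2)) (use a in force)+
  \<comment> \<open>trace of the fixed point equation against \<open>X\<^sup>-\<^sup>q\<^sup>-\<^sup>1\<close>\<close>
  have "s * g powr (1 + t / q) = (\<Sum>j=1..m. w j * (a j powr (- t / q) * g powr (1 + t / q)))"
    by (simp add: s_def sum_distrib_right mult.assoc)
  also have "\<dots> \<le> (\<Sum>j=1..m. w j * rtrace (geo_mean t X (matrix_inv (A j)) ** mat_powr X (- q - 1)))"
    unfolding a_def g_def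
    by (intro sum_mono mult_left_mono rtrace_geo_mean_lower_bound X assms t) (auto simp: assms(2) less_imp_le)
  also have "\<dots> = rtrace ((\<Sum>j=1..m. w j *\<^sub>R geo_mean t X (matrix_inv (A j))) ** mat_powr X (- q - 1))"
    by (simp add: matrix_sum_rdistrib rtrace_sum flip: scalar_matrix_assoc)
       (simp add: trace_def sum_distrib_left)
  also have "\<dots> = rtrace (mat_powr X 1 ** mat_powr X (- q - 1))"
    using fixpoint by (simp add: mat_powr_1 X)
  also have "\<dots> = g" by (simp add: mat_powr_mult X g_def)
  finally have "s * g powr (t / q) \<le> 1"
    using g by (simp add: powr_add)
  then have "(s * g powr (t / q)) powr (1 / t) \<le> 1 powr (1 / t)"
    using s t by (intro powr_mono2) auto
  then have "s powr (1 / t) * g powr (1 / q) \<le> 1"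
    using s t by (simp add: powr_mult powr_powr less_imp_le)
  then have "g powr (1 / q) \<le> s powr (- 1 / t)"
    using s by (simp add: powr_minus field_simps)
  then show ?thesis by (simp only: lhs rhs)
qed

end
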